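(* Let $k$ be an integer with $k\neq-1,0$, and let $K$ be the $(-2,3,2k+1)$ pretzel knot. Then there is a 3-dimensional irreducible KCH representation of $\pi_K$. Furthermore, $(1-\lambda\mu^{2k+6})$ divides $A_K^3(\lambda,\mu)$.
   Context: $K$ is the $(-2,3,2k+1)$ pretzel knot: its standard diagram has three columns of twists with $2$, $3$ and $|2k+1|$ crossings, signs as indicated. The chirality convention is that the blackboard framing (writhe) of this standard diagram is $2k+6$ (so for $k\ge1$ all crossings are positive; e.g. the $(-2,3,3)$ pretzel knot is the positive torus knot $T(3,4)$). The knot group is $\pi_K=\langle m,w\mid w^kE=Fw^k\rangle$, where $m$ is a meridian, $E=mwm^{-1}w^{-1}m^{-1}$, $F=m^{-1}w^{-1}mwmw^{-1}$, and $w$ is a product of two meridians. Let $\ell\in\pi_K$ be the $0$-framed longitude commuting with $m$. A homomorphism $\rho:\pi_K\to\mathrm{GL}(V)$, $\dim_{\mathbb C}V=n$, is a KCH representation of degree $n$ (an $n$-dimensional KCH representation) if $\rho(m)$ is diagonalizable and has $1$ as an eigenvalue with multiplicity exactly $n-1$. Let $e_1$ be an eigenvector of $\rho(m)$ for the remaining eigenvalue $\mu_0\ne1$; then $e_1$ is an eigenvector of $\rho(\ell)$, with eigenvalue $\lambda_0$ say. Let $U_K^n\subset(\mathbb{C}^* )^2$ be the set of all pairs $(\lambda_0,\mu_0)$ arising from KCH representations of degree $n$. The $n$-dimensional $A$-polynomial $A_K^n(\lambda,\mu)$ is the reduced polynomial (no repeated factors), defined up to a unit in $\mathbb{C}[\lambda^{\pm1},\mu^{\pm1}]$,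 whose zero locus is the 1-dimensional part of the closure of $U_K^n$ (it is defined when there is no 2-dimensional component). *)

theory Defs
  imports
    "HOL-Analysis.Analysis"
    "HOL-Algebra.Group"
    "HOL-Library.Poly_Mapping"
    "HOL-Computational_Algebra.Squarefree"
begin

section \<open>Group presentations\<close>

text \<open>A word is a list of letters; the letter \<open>(x, False)\<close> stands for the generator \<open>x\<close> and
  \<open>(x, True)\<close> for its formal inverse.\<close>

type_synonym 'g word = "('g \<times> bool) list"

definition letter :: "'g \<Rightarrow> 'g word" where
  "letter x = [(x, False)]"

definition word_inv :: "'g word \<Rightarrow> 'g word" where
  "word_inv u = rev (map (\<lambda>(x, b). (x, \<not> b)) u)"

definition word_pow :: "'g word \<Rightarrow> int \<Rightarrow> 'g word" where
  "word_pow u i = (if i \<ge> 0 then concat (replicate (nat i) u)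
                   else concat (replicate (nat (- i)) (word_inv u)))"

inductive pres_eq :: "('g word \<times> 'g word) set \<Rightarrow> 'g word \<Rightarrow> 'g word \<Rightarrow> bool"
  for R :: "('g word \<times> 'g word) set" where
  pres_rel: "(u, v) \<in> R \<Longrightarrow> pres_eq R u v"
| pres_cancel: "pres_eq R [(x, b), (x, \<not> b)] []"
| pres_refl: "pres_eq R u u"
| pres_sym: "pres_eq R u v \<Longrightarrow> pres_eq R v u"
| pres_trans: "pres_eq R u v \<Longrightarrow> pres_eq R v w \<Longrightarrow> pres_eq R u w"
| pres_append: "pres_eq R u v \<Longrightarrow> pres_eq R u' v' \<Longrightarrow> pres_eq R (u @ u') (v @ v')"

definition pres_class :: "('g word \<times> 'g word) set \<Rightarrow> 'g word \<Rightarrow> 'g word set" where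
  "pres_class R u = {v. pres_eq R u v}"

text \<open>The group with all elements of \<^typ>\<open>'g\<close> as generators and the relations \<open>u = v\<close> for
  \<open>(u, v) \<in> R\<close>.\<close>

definition presented_group :: "('g word \<times> 'g word) set \<Rightarrow> 'g word set monoid" where
  "presented_group R =
    \<lparr>carrier = range (pres_class R),
     mult = (\<lambda>A B. {w. \<exists>u\<in>A. \<exists>v\<in>B. pres_eq R (u @ v) w}),
     one = pres_class R []\<rparr>"

lemma pres_class_eq_iff: "pres_class R u = pres_class R v \<longleftrightarrow> pres_eq R u v"
  unfolding pres_class_def set_eq_iff mem_Collect_eq
  by (meson pres_refl pres_sym pres_trans)

lemma presented_group_mult:
  "pres_class R u \<otimes>\<^bsub>presented_group R\<^esub> pres_class R v = pres_class R (u @ v)"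
  unfolding presented_group_def pres_class_def
  by (auto, (meson pres_append pres_refl pres_sym pres_trans)+)

lemma pres_inverse: "pres_eq R (word_inv u @ u) []"
proof (induction u)
  case (Cons a u)
  obtain x b where a: "a = (x, b)" by force
  have "pres_eq R ((word_inv u @ [(x, \<not> b), (x, b)]) @ u) ((word_inv u @ []) @ u)"
    using pres_cancel[of R x "\<not> b"] by (intro pres_append pres_refl) simp
  then show ?case using Cons a by (auto simp: word_inv_def intro: pres_trans)
qed (simp add: word_inv_def pres_refl)

lemma group_presented_group: "group (presented_group R)"
proof (rule groupI)
  let ?G = "presented_group R"
  have car: "carrier ?G = range (pres_class R)" and one: "\<one>\<^bsub>?G\<^esub> = pres_class R []"
    by (simp_all add: presented_group_def)
  show "\<one>\<^bsub>?G\<^esub> \<in> carrier ?G" by (simp add: car one)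
  fix x assume "x \<in> carrier ?G"
  then obtain u where u: "x = pres_class R u" by (auto simp: car)
  show "\<one>\<^bsub>?G\<^esub> \<otimes>\<^bsub>?G\<^esub> x = x" by (simp add: one u presented_group_mult)
  show "\<exists>y\<in>carrier ?G. y \<otimes>\<^bsub>?G\<^esub> x = \<one>\<^bsub>?G\<^esub>"
    by (rule bexI[of _ "pres_class R (word_inv u)"])
      (auto simp: car one u presented_group_mult pres_class_eq_iff pres_inverse)
  fix y assume "y \<in> carrier ?G"
  then obtain v where v: "y = pres_class R v" by (auto simp: car)
  show "x \<otimes>\<^bsub>?G\<^esub> y \<in> carrier ?G" by (simp add: car u v presented_group_mult)
  fix z assume "z \<in> carrier ?G"
  then obtain w where w: "z = pres_class R w" by (auto simp: car)
  show "x \<otimes>\<^bsub>?G\<^esub> y \<otimes>\<^bsub>?G\<^esub> z = x \<otimes>\<^bsub>?G\<^esub> (y \<otimes>\<^bsub>?G\<^esub> z)"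
    by (simp add: u v w presented_group_mult)
qed


lemma pres_class_carrier: "pres_class R u \<in> carrier (presented_group R)"
  by (simp add: presented_group_def)

lemma pres_class_word_inv:
  "pres_class R (word_inv u) = inv\<^bsub>presented_group R\<^esub> pres_class R u"
proof -
  interpret group "presented_group R" by (rule group_presented_group)
  have "pres_class R (word_inv u) \<otimes>\<^bsub>presented_group R\<^esub> pres_class R u = \<one>\<^bsub>presented_group R\<^esub>"
    unfolding presented_group_mult by (simp add: presented_group_def pres_class_eq_iff pres_inverse)
  then show ?thesis by (intro inv_equality[symmetric] pres_class_carrier)
qed

lemma pres_class_word_pow:
  "pres_class R (word_pow u i) = pres_class R u [^]\<^bsub>presented_group R\<^esub> i"
proof -
  interpret group "presented_group R" by (rule group_presented_group)
  have pow: "pres_class R (concat (replicate n v)) = pres_class R v [^]\<^bsub>presented_group R\<^esub> n"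
    for n :: nat and v
  proof (induction n)
    case 0
    show ?case by (simp add: presented_group_def)
  next
    case (Suc n)
    have "pres_class R (concat (replicate (Suc n) v)) =
        pres_class R v \<otimes>\<^bsub>presented_group R\<^esub> pres_class R (concat (replicate n v))"
      unfolding presented_group_mult by simp
    also have "\<dots> = pres_class R v [^]\<^bsub>presented_group R\<^esub> Suc n"
      unfolding Suc by (rule nat_pow_Suc2[OF pres_class_carrier, symmetric])
    finally show ?case .
  qed
  show ?thesis
  proof (cases "i < 0")
    case True
    then have "pres_class R (word_pow u i) =
        pres_class R (word_inv u) [^]\<^bsub>presented_group R\<^esub> nat (- i)"
      by (simp only: word_pow_def not_le[symmetric] if_False pow)
    also have "\<dots> = pres_class R u [^]\<^bsub>presented_group R\<^esub> i"
      using True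
      by (simp only: pres_class_word_inv nat_pow_inv[OF pres_class_carrier] int_pow_def2 if_True)
    finally show ?thesis .
  next
    case False
    then show ?thesis by (simp only: word_pow_def not_less if_True pow int_pow_def2 if_False)
        (simp add: pow)
  qed
qed


section \<open>The knot group of the \<open>(-2, 3, 2k+1)\<close> pretzel knot\<close>

datatype gen = Gen_m | Gen_w

abbreviation (input) m_word :: "gen word" where "m_word \<equiv> letter Gen_m"
abbreviation (input) w_word :: "gen word" where "w_word \<equiv> letter Gen_w"

definition E_word :: "gen word" where
  "E_word = m_word @ w_word @ word_inv m_word @ word_inv w_word @ word_inv m_word"

definition F_word :: "gen word" where
  "F_word = word_inv m_word @ word_inv w_word @ m_word @ w_word @ m_word @ word_inv w_word"

definition pretzel_rel :: "int \<Rightarrow> (gen word \<times> gen word) set" where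
  "pretzel_rel k = {(word_pow w_word k @ E_word, F_word @ word_pow w_word k)}"

definition pretzel_group :: "int \<Rightarrow> gen word set monoid" where
  "pretzel_group k = presented_group (pretzel_rel k)"

definition meridian :: "int \<Rightarrow> gen word set" where
  "meridian k = pres_class (pretzel_rel k) m_word"

text \<open>The \<open>0\<close>-framed longitude as a word in the generators: put
  \<open>u = w m w\<^sup>k\<^sup>-\<^sup>1 m w\<close>. The defining relation is equivalent to \<open>m u m = w m w\<^sup>k m w\<close>, from which
  \<open>u w\<^sup>-\<^sup>1 u\<close> commutes with \<open>m\<close> (see \<open>longitude_commutes\<close>). In the
  abelianization, \<open>m\<close> and \<open>w\<close> have classes \<open>1\<close> and \<open>2\<close>, so
  \<open>\<ell> = u w\<^sup>-\<^sup>1 u m\<^sup>-\<^sup>(\<^sup>4\<^sup>k\<^sup>+\<^sup>6\<^sup>)\<close> is null-homologous. It is oriented parallel to the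
  knot whose standard diagram has writhe \<open>2k + 6\<close>. For example, for \<open>k = 1\<close> (the positive torus
  knot \<open>T(3,4)\<close>) the relation is equivalent to \<open>(m w m)\<^sup>3 = (w m)\<^sup>4\<close>, this element is
  central, and \<open>m\<^sup>1\<^sup>2 \<ell>\<close> is equal to it, in accordance with the fibre slope \<open>12\<close>.\<close>

definition longitude_word :: "int \<Rightarrow> gen word" where
  "longitude_word k =
     w_word @ m_word @ word_pow w_word (k - 1) @ m_word @ w_word @ m_word
     @ word_pow w_word (k - 1) @ m_word @ w_word @ word_pow m_word (- (4 * k + 6))"

definition longitude :: "int \<Rightarrow> gen word set" where
  "longitude k = pres_class (pretzel_rel k) (longitude_word k)"

lemma (in group) commutes_of_pretzel_relation:
  assumes G: "m \<in> carrier G" "w \<in> carrier G" "t \<in> carrier G"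
    and tw: "t \<otimes> w = w \<otimes> t"
    and rel: "t \<otimes> w \<otimes> (m \<otimes> w \<otimes> inv m \<otimes> inv w \<otimes> inv m) =
              inv m \<otimes> inv w \<otimes> m \<otimes> w \<otimes> m \<otimes> inv w \<otimes> (t \<otimes> w)"
  defines "h \<equiv> w \<otimes> m \<otimes> t \<otimes> m \<otimes> w \<otimes> m \<otimes> t \<otimes> m \<otimes> w"
  shows "m \<otimes> h = h \<otimes> m"
proof -
  have c1: "inv x \<otimes> (x \<otimes> y) = y" and c2: "x \<otimes> (inv x \<otimes> y) = y"
    if "x \<in> carrier G" "y \<in> carrier G" for x y
    using that by (simp_all add: m_assoc[symmetric])
  note nf = m_assoc c1 c2 G
  have tw': "t \<otimes> (w \<otimes> x) = w \<otimes> (t \<otimes> x)" if "x \<in> carrier G" for x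
    using tw that G by (metis m_assoc)
  have "w \<otimes> m \<otimes> (t \<otimes> w \<otimes> (m \<otimes> w \<otimes> inv m \<otimes> inv w \<otimes> inv m)) \<otimes> (m \<otimes> w \<otimes> m) =
        w \<otimes> m \<otimes> (inv m \<otimes> inv w \<otimes> m \<otimes> w \<otimes> m \<otimes> inv w \<otimes> (t \<otimes> w)) \<otimes> (m \<otimes> w \<otimes> m)"
    by (simp only: rel)
  then have R: "w \<otimes> m \<otimes> w \<otimes> t \<otimes> m \<otimes> w = m \<otimes> w \<otimes> m \<otimes> t \<otimes> m \<otimes> w \<otimes> m"
    by (simp add: nf tw')
  have "m \<otimes> h = (m \<otimes> w \<otimes> m \<otimes> t \<otimes> m \<otimes> w \<otimes> m) \<otimes> (t \<otimes> m \<otimes> w)"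
    unfolding h_def by (simp add: nf)
  also have "\<dots> = w \<otimes> m \<otimes> t \<otimes> (w \<otimes> m \<otimes> w \<otimes> t \<otimes> m \<otimes> w)"
    unfolding R[symmetric] by (simp add: nf tw')
  also have "\<dots> = h \<otimes> m"
    unfolding R h_def by (simp add: nf)
  finally show ?thesis .
qed

lemma longitude_commutes:
  "meridian k \<otimes>\<^bsub>pretzel_group k\<^esub> longitude k = longitude k \<otimes>\<^bsub>pretzel_group k\<^esub> meridian k"
proof -
  let ?R = "pretzel_rel k"
  let ?G = "presented_group ?R"
  interpret group ?G by (rule group_presented_group)
  define m w where "m = pres_class ?R m_word" and "w = pres_class ?R w_word"
  define t where "t = w [^]\<^bsub>?G\<^esub> (k - 1)"
  have G: "m \<in> carrier ?G" "w \<in> carrier ?G" "t \<in> carrier ?G"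
    by (simp_all add: m_def w_def t_def pres_class_carrier)
  note cls = presented_group_mult[symmetric]
  have tw: "t \<otimes>\<^bsub>?G\<^esub> w = w [^]\<^bsub>?G\<^esub> k" "w \<otimes>\<^bsub>?G\<^esub> t = w [^]\<^bsub>?G\<^esub> k"
    using int_pow_mult[of w "k - 1" 1] int_pow_mult[of w 1 "k - 1"] G
    by (simp_all add: t_def int_pow_1)
  have "pres_class ?R (word_pow w_word k @ E_word) = pres_class ?R (F_word @ word_pow w_word k)"
    unfolding pres_class_eq_iff by (rule pres_rel) (simp add: pretzel_rel_def)
  then have rel: "t \<otimes>\<^bsub>?G\<^esub> w \<otimes>\<^bsub>?G\<^esub> (m \<otimes>\<^bsub>?G\<^esub> w \<otimes>\<^bsub>?G\<^esub> inv\<^bsub>?G\<^esub> m \<otimes>\<^bsub>?G\<^esub> inv\<^bsub>?G\<^esub> w \<otimes>\<^bsub>?G\<^esub> inv\<^bsub>?G\<^esub> m) =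
      inv\<^bsub>?G\<^esub> m \<otimes>\<^bsub>?G\<^esub> inv\<^bsub>?G\<^esub> w \<otimes>\<^bsub>?G\<^esub> m \<otimes>\<^bsub>?G\<^esub> w \<otimes>\<^bsub>?G\<^esub> m \<otimes>\<^bsub>?G\<^esub> inv\<^bsub>?G\<^esub> w \<otimes>\<^bsub>?G\<^esub> (t \<otimes>\<^bsub>?G\<^esub> w)"
    unfolding tw E_word_def F_word_def cls pres_class_word_pow pres_class_word_inv
      m_def[symmetric] w_def[symmetric]
    using G by (simp add: m_assoc)
  let ?h = "w \<otimes>\<^bsub>?G\<^esub> m \<otimes>\<^bsub>?G\<^esub> t \<otimes>\<^bsub>?G\<^esub> m \<otimes>\<^bsub>?G\<^esub> w \<otimes>\<^bsub>?G\<^esub> m \<otimes>\<^bsub>?G\<^esub> t \<otimes>\<^bsub>?G\<^esub> m \<otimes>\<^bsub>?G\<^esub> w"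
  let ?z = "m [^]\<^bsub>?G\<^esub> (- (4 * k + 6))"
  have h: "m \<otimes>\<^bsub>?G\<^esub> ?h = ?h \<otimes>\<^bsub>?G\<^esub> m"
    by (rule commutes_of_pretzel_relation[OF G trans[OF tw(1) tw(2)[symmetric]] rel])
  have z: "m \<otimes>\<^bsub>?G\<^esub> ?z = ?z \<otimes>\<^bsub>?G\<^esub> m"
    using G(1) by (metis add.commute int_pow_1 int_pow_mult)
  have l: "longitude k = ?h \<otimes>\<^bsub>?G\<^esub> ?z"
    unfolding longitude_def longitude_word_def cls pres_class_word_pow
      m_def[symmetric] w_def[symmetric] t_def[symmetric]
    using G by (simp add: m_assoc)
  have hG: "?h \<in> carrier ?G" and zG: "?z \<in> carrier ?G"
    using G by simp_all
  have "m \<otimes>\<^bsub>?G\<^esub> (?h \<otimes>\<^bsub>?G\<^esub> ?z) = ?h \<otimes>\<^bsub>?G\<^esub> ?z \<otimes>\<^bsub>?G\<^esub> m"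
    by (metis h z hG zG G(1) m_assoc)
  then show ?thesis
    unfolding meridian_def pretzel_group_def m_def[symmetric] l .
qed


section \<open>KCH representations\<close>

definition GL :: "(complex ^ 'n ^ 'n) monoid" where
  "GL = \<lparr>carrier = {A. invertible A}, mult = (**), one = mat 1\<rparr>"

definition diagonalizable :: "complex ^ 'n ^ 'n \<Rightarrow> bool" where
  "diagonalizable A \<longleftrightarrow>
     (\<exists>P D :: complex ^ 'n ^ 'n. invertible P \<and> (\<forall>i j. i \<noteq> j \<longrightarrow> D $ i $ j = 0) \<and> A = P ** D ** matrix_inv P)"

text \<open>For a diagonalizable matrix the multiplicity of an eigenvalue is the dimension of its
  eigenspace; the degree of the representation is \<^term>\<open>CARD('n)\<close>.\<close>

definition KCH_rep :: "int \<Rightarrow> (gen word set \<Rightarrow> complex ^ 'n ^ 'n) \<Rightarrow> bool" where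
  "KCH_rep k \<rho> \<longleftrightarrow> \<rho> \<in> hom (pretzel_group k) GL \<and>
     diagonalizable (\<rho> (meridian k)) \<and>
     vec.dim {v. \<rho> (meridian k) *v v = v} = CARD('n) - 1"

definition irreducible_rep :: "int \<Rightarrow> (gen word set \<Rightarrow> complex ^ 'n ^ 'n) \<Rightarrow> bool" where
  "irreducible_rep k \<rho> \<longleftrightarrow>
     (\<forall>W. vec.subspace W \<and> (\<forall>g\<in>carrier (pretzel_group k). \<forall>v\<in>W. \<rho> g *v v \<in> W)
        \<longrightarrow> W = {0} \<or> W = UNIV)"

text \<open>The set \<open>U\<^sub>K\<^sup>n\<close> of pairs \<open>(\<lambda>\<^sub>0, \<mu>\<^sub>0)\<close>, where \<open>n\<close> is \<^term>\<open>CARD('n)\<close>. Both numbers are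
  automatically nonzero.\<close>

definition KCH_eigenvalues :: "int \<Rightarrow> 'n::finite itself \<Rightarrow> (complex \<times> complex) set" where
  "KCH_eigenvalues k _ =
     {(l, \<mu>). \<exists>(\<rho> :: gen word set \<Rightarrow> complex ^ 'n ^ 'n) e. KCH_rep k \<rho> \<and> e \<noteq> 0 \<and> \<mu> \<noteq> 1 \<and>
        \<rho> (meridian k) *v e = \<mu> *s e \<and> \<rho> (longitude k) *v e = l *s e}"


section \<open>Zariski topology of the torus \<open>(\<complex>\<^sup>*)\<^sup>2\<close>\<close>

text \<open>The ring \<open>\<complex>[\<lambda>\<^sup>\<plusminus>\<^sup>1, \<mu>\<^sup>\<plusminus>\<^sup>1]\<close>: the coefficient at \<open>(i, j)\<close> belongs to \<open>\<lambda>\<^sup>i \<mu>\<^sup>j\<close>.\<close>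

type_synonym laurent2 = "(int \<times> int) \<Rightarrow>\<^sub>0 complex"

definition laurent_eval :: "laurent2 \<Rightarrow> complex \<times> complex \<Rightarrow> complex" where
  "laurent_eval f p = (\<Sum>(i, j)\<in>Poly_Mapping.keys f.
     Poly_Mapping.lookup f (i, j) * fst p powi i * snd p powi j)"

definition torus :: "(complex \<times> complex) set" where
  "torus = {(l, \<mu>). l \<noteq> 0 \<and> \<mu> \<noteq> 0}"

definition zero_locus :: "laurent2 \<Rightarrow> (complex \<times> complex) set" where
  "zero_locus f = {p \<in> torus. laurent_eval f p = 0}"

definition zariski_closed :: "(complex \<times> complex) set \<Rightarrow> bool" where
  "zariski_closed X \<longleftrightarrow> (\<exists>S. X = torus \<inter> (\<Inter>f\<in>S. zero_locus f))"

definition zariski_irreducible :: "(complex \<times> complex) set \<Rightarrow> bool" where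
  "zariski_irreducible Z \<longleftrightarrow> zariski_closed Z \<and> Z \<noteq> {} \<and>
     (\<forall>A B. zariski_closed A \<and> zariski_closed B \<and> Z = A \<union> B \<longrightarrow> Z = A \<or> Z = B)"

definition irreducible_component ::
    "(complex \<times> complex) set \<Rightarrow> (complex \<times> complex) set \<Rightarrow> bool" where
  "irreducible_component Z X \<longleftrightarrow> zariski_irreducible Z \<and> Z \<subseteq> X \<and>
     (\<forall>Z'. zariski_irreducible Z' \<and> Z \<subseteq> Z' \<and> Z' \<subseteq> X \<longrightarrow> Z' = Z)"

definition zariski_dim :: "(complex \<times> complex) set \<Rightarrow> enat" where
  "zariski_dim X = Sup {enat d | d. \<exists>C :: nat \<Rightarrow> (complex \<times> complex) set.
     (\<forall>i\<le>d. zariski_irreducible (C i) \<and> C i \<subseteq> X) \<and> (\<forall>i<d. C i \<subset> C (Suc i))}"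


section \<open>The \<open>n\<close>-dimensional A-polynomial\<close>

text \<open>\<open>A\<close> is a representative of \<open>A\<^sub>K\<^sup>n\<close>, which is determined only up to a unit of the Laurent
  polynomial ring and is defined only if the closure of \<open>U\<^sub>K\<^sup>n\<close> has no \<open>2\<close>-dimensional
  component.\<close>

definition is_A_polynomial :: "int \<Rightarrow> 'n::finite itself \<Rightarrow> laurent2 \<Rightarrow> bool" where
  "is_A_polynomial k n A \<longleftrightarrow>
     (let V = zariski_closed hull KCH_eigenvalues k n in
       (\<nexists>Z. irreducible_component Z V \<and> zariski_dim Z = 2) \<and>
       squarefree A \<and>
       zero_locus A = \<Union>{Z. irreducible_component Z V \<and> zariski_dim Z = 1})"

end

theory Submission
imports Defs "HOL-Computational_Algebra.Fundamental_Theorem_Algebra"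
begin

text \<open>If complex reflections \<open>a, b, c\<close> with the same eigenvalue \<open>\<mu>\<close> satisfy \<open>a b a = b a b\<close>, \<open>a c = c a\<close>
  and the Artin relation of length \<open>2k + 1\<close> between \<open>b\<close> and \<open>c\<close>, then \<open>m \<mapsto> a\<close>, \<open>w \<mapsto> c b\<close> respects the
  relation of the knot group. Such reflections of \<open>\<complex>\<^sup>3\<close> exist for almost every \<open>\<mu>\<close>: they form the
  reflection representation of the Hecke algebra of the triangle with labels \<open>3, 2, 2k+1\<close>. The
  longitude has eigenvalue \<open>\<mu>\<^sup>-\<^sup>(\<^sup>2\<^sup>k\<^sup>+\<^sup>6\<^sup>)\<close> on the root of \<open>a\<close>, so infinitely many points of the irreducible curve
  \<open>\<lambda> \<mu>\<^sup>2\<^sup>k\<^sup>+\<^sup>6 = 1\<close>, and therefore the whole curve, lie in the closure of \<open>U\<^sub>K\<^sup>3\<close>. As the torus has dimension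
  two, the curve is a component of this closure unless the closure is the whole torus, in which case
  there is no A-polynomial.\<close>

subsection \<open>Evaluation of Laurent polynomials\<close>

lemma laurent_eval_superset:
  assumes "finite S" "Poly_Mapping.keys f \<subseteq> S"
  shows "laurent_eval f p =
    (\<Sum>(i, j)\<in>S. Poly_Mapping.lookup f (i, j) * fst p powi i * snd p powi j)"
  unfolding laurent_eval_def using assms
  by (intro sum.mono_neutral_left) (auto simp: Poly_Mapping.in_keys_iff)

lemma laurent_eval_0 [simp]: "laurent_eval 0 p = 0"
  by (simp add: laurent_eval_def)

lemma laurent_eval_add: "laurent_eval (f + g) p = laurent_eval f p + laurent_eval g p"
proof -
  define S where "S = Poly_Mapping.keys f \<union> Poly_Mapping.keys g"
  have S: "finite S" "Poly_Mapping.keys f \<subseteq> S" "Poly_Mapping.keys g \<subseteq> S"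
      "Poly_Mapping.keys (f + g) \<subseteq> S"
    using Poly_Mapping.keys_add[of f g] by (auto simp: S_def)
  show ?thesis
    unfolding laurent_eval_superset[OF S(1,2)] laurent_eval_superset[OF S(1,3)]
      laurent_eval_superset[OF S(1,4)]
    by (simp add: lookup_add algebra_simps sum.distrib case_prod_unfold)
qed

lemma laurent_eval_sum: "laurent_eval (\<Sum>i\<in>I. f i) p = (\<Sum>i\<in>I. laurent_eval (f i) p)"
  by (induction I rule: infinite_finite_induct) (simp_all add: laurent_eval_add)

lemma laurent_eval_single:
  "laurent_eval (Poly_Mapping.single (i, j) c) p = c * fst p powi i * snd p powi j"
  by (subst laurent_eval_superset[of "{(i, j)}"]) auto

lemma laurent_eval_uminus: "laurent_eval (- f) p = - laurent_eval f p"
  using laurent_eval_add[of f "- f" p] by (simp add: add_eq_0_iff)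

lemma laurent_eval_diff: "laurent_eval (f - g) p = laurent_eval f p - laurent_eval g p"
  using laurent_eval_add[of f "- g" p] by (simp add: laurent_eval_uminus)

lemma sum_single_lookup:
  "(\<Sum>x\<in>Poly_Mapping.keys f. Poly_Mapping.single x (Poly_Mapping.lookup f x)) = f"
  by (rule poly_mapping_eqI)
    (simp add: lookup_sum lookup_single when_def Poly_Mapping.in_keys_iff)

text \<open>The outer variable is \<mu> = \<open>snd p\<close> and the coefficients are polynomials
  in \<lambda> = \<open>fst p\<close>. The degree of a \<open>complex poly poly\<close> is thus its
  degree in \<mu>, and \<open>[:r:]\<close> is a polynomial in \<lambda> alone.\<close>

definition eval2 :: "complex poly poly \<Rightarrow> complex \<times> complex \<Rightarrow> complex" where
  "eval2 P p = poly (poly P [:snd p:]) (fst p)"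

lemma eval2_simps [simp]:
  "eval2 0 p = 0" "eval2 1 p = 1"
  "eval2 (P + Q) p = eval2 P p + eval2 Q p" "eval2 (P - Q) p = eval2 P p - eval2 Q p"
  "eval2 (P * Q) p = eval2 P p * eval2 Q p" "eval2 (P ^ n) p = eval2 P p ^ n"
  "eval2 (smult a P) p = poly a (fst p) * eval2 P p" "eval2 [:a:] p = poly a (fst p)"
  by (simp_all add: eval2_def)

lemma eval2_monom: "eval2 (monom (monom c i) j) p = c * fst p ^ i * snd p ^ j"
  by (simp add: eval2_def poly_monom poly_const_pow)

lemma eval2_sum: "eval2 (\<Sum>i\<in>I. f i) p = (\<Sum>i\<in>I. eval2 (f i) p)"
  by (induction I rule: infinite_finite_induct) simp_all

lemma eval2_altdef:
  "eval2 P p = (\<Sum>j\<le>degree P. \<Sum>i\<le>degree (coeff P j). coeff (coeff P j) i * fst p ^ i * snd p ^ j)"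
  by (simp add: eval2_def poly_altdef[of P] poly_sum poly_altdef[of "coeff P _"] sum_distrib_right)

text \<open>For fixed \<open>y\<close> the polynomial in \<lambda> has infinitely many roots and so
  vanishes; hence \<open>P\<close>, over the domain of polynomials in \<lambda>, has infinitely many
  constant roots \<open>[:y:]\<close>.\<close>

lemma eval2_eq_0:
  assumes "infinite X" "infinite Y" and "\<And>x y. x \<in> X \<Longrightarrow> y \<in> Y \<Longrightarrow> eval2 P (x, y) = 0"
  shows "P = 0"
proof (rule ccontr)
  assume "P \<noteq> 0"
  have "poly P [:y:] = 0" if "y \<in> Y" for y
  proof (rule ccontr)
    assume "poly P [:y:] \<noteq> 0"
    then have "finite {x. poly (poly P [:y:]) x = 0}" by (rule poly_roots_finite)
    moreover have "X \<subseteq> {x. poly (poly P [:y:]) x = 0}"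
      using assms(3) that by (auto simp: eval2_def)
    ultimately show False using assms(1) finite_subset by blast
  qed
  then have "(\<lambda>y. [:y:]) ` Y \<subseteq> {a. poly P a = 0}" by auto
  moreover have "infinite ((\<lambda>y::complex. [:y:]) ` Y)"
    using assms(2) by (subst finite_image_iff) (auto intro: inj_onI)
  ultimately show False using poly_roots_finite[OF \<open>P \<noteq> 0\<close>] finite_subset by blast
qed

lemma ex_laurent_eval_eq_eval2: "\<exists>f. \<forall>p. laurent_eval f p = eval2 P p"
  by (rule exI[of _ "\<Sum>j\<le>degree P. \<Sum>i\<le>degree (coeff P j).
      Poly_Mapping.single (int i, int j) (coeff (coeff P j) i)"])
    (simp add: laurent_eval_sum laurent_eval_single eval2_altdef)

text \<open>Multiplication by a high power of \<lambda> \<mu> clears the negative exponents and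
  changes no zeros on the torus.\<close>

lemma ex_eval2_eq_laurent_eval:
  obtains P N where "\<And>p. p \<in> torus \<Longrightarrow> eval2 P p = fst p ^ N * snd p ^ N * laurent_eval f p"
    and "P = 0 \<Longrightarrow> f = 0"
proof -
  define K where "K = Poly_Mapping.keys f"
  \<comment> \<open>The sum over all keys bounds each single exponent, so every exponent shifted by
    \<open>N\<close> is nonnegative.\<close>
  define N where "N = (\<Sum>(i, j)\<in>K. nat \<bar>i\<bar> + nat \<bar>j\<bar>)"
  have N: "i + int N \<ge> 0" "j + int N \<ge> 0" if "(i, j) \<in> K" for i j
  proof -
    have "(case (i, j) of (i, j) \<Rightarrow> nat \<bar>i\<bar> + nat \<bar>j\<bar>) \<le> N"
      unfolding N_def by (rule member_le_sum) (use that in \<open>auto simp: K_def\<close>)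
    then show "i + int N \<ge> 0" "j + int N \<ge> 0" by auto
  qed
  define P where "P = (\<Sum>(i, j)\<in>K.
    monom (monom (Poly_Mapping.lookup f (i, j)) (nat (i + int N))) (nat (j + int N)))"
  have pw: "z ^ nat (i + int N) = z ^ N * z powi i" if "i + int N \<ge> 0" "z \<noteq> 0"
    for i and z :: complex
    using that by (simp add: power_int_add power_int_def[of z "i + int N", symmetric]
        flip: power_int_of_nat)
  have "eval2 P p = fst p ^ N * snd p ^ N * laurent_eval f p" if p: "p \<in> torus" for p
    unfolding P_def laurent_eval_def K_def[symmetric] eval2_sum sum_distrib_left case_prod_unfold
      eval2_monom
    by (intro sum.cong refl) (use N p in \<open>auto simp: torus_def pw algebra_simps\<close>)
  moreover have "f = 0" if P: "P = 0"
  proof -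
    have "Poly_Mapping.lookup f (a, b) = 0" if ab: "(a, b) \<in> K" for a b
    proof -
      \<comment> \<open>The shift by \<open>N\<close> keeps distinct exponents distinct, so exactly
        one monomial contributes to this coefficient.\<close>
      have "coeff (coeff P (nat (b + int N))) (nat (a + int N)) =
          (\<Sum>x\<in>K. if x = (a, b) then Poly_Mapping.lookup f x else 0)"
        unfolding P_def coeff_sum case_prod_unfold
        by (intro sum.cong refl) (use N ab in \<open>auto simp: eq_nat_nat_iff\<close>)
      also have "\<dots> = Poly_Mapping.lookup f (a, b)"
        using ab by (simp add: K_def)
      finally show ?thesis using P by simp
    qed
    then have "K = {}" unfolding K_def by (metis Poly_Mapping.in_keys_iff equals0I surj_pair)
    then show ?thesis by (simp add: K_def)
  qed
  ultimately show thesis by (rule that)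
qed

subsection \<open>Irreducible closed sets\<close>

definition vanishes_on :: "complex poly poly \<Rightarrow> (complex \<times> complex) set \<Rightarrow> bool" where
  "vanishes_on P Z \<longleftrightarrow> (\<forall>p\<in>Z. eval2 P p = 0)"

lemma vanishes_on_mono: "vanishes_on P Z \<Longrightarrow> Y \<subseteq> Z \<Longrightarrow> vanishes_on P Y"
  by (auto simp: vanishes_on_def)

lemma zariski_closed_torus [simp]: "zariski_closed torus"
  unfolding zariski_closed_def by (rule exI[of _ "{}"]) auto

lemma zariski_closed_subset_torus: "zariski_closed Z \<Longrightarrow> Z \<subseteq> torus"
  by (auto simp: zariski_closed_def)

lemma zariski_irreducible_subset_torus: "zariski_irreducible Z \<Longrightarrow> Z \<subseteq> torus"
  by (auto simp: zariski_irreducible_def zariski_closed_subset_torus)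

lemma zariski_closed_zero_locus: "zariski_closed (zero_locus f)"
  unfolding zariski_closed_def by (rule exI[of _ "{f}"]) (auto simp: zero_locus_def)

lemma zariski_closed_Int:
  assumes "zariski_closed A" "zariski_closed B"
  shows "zariski_closed (A \<inter> B)"
proof -
  obtain S T where "A = torus \<inter> (\<Inter>f\<in>S. zero_locus f)" "B = torus \<inter> (\<Inter>f\<in>T. zero_locus f)"
    using assms unfolding zariski_closed_def by blast
  then show ?thesis unfolding zariski_closed_def by (intro exI[of _ "S \<union> T"]) blast
qed

lemma zariski_closed_eval2: "zariski_closed {p \<in> torus. eval2 P p = 0}"
  by (metis (no_types, lifting) ex_laurent_eval_eq_eval2[of P] zariski_closed_zero_locus
      zero_locus_def Collect_cong)

lemma zariski_closed_separating_laurent: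
  assumes "zariski_closed A" "p \<in> torus" "p \<notin> A"
  obtains f where "\<And>q. q \<in> A \<Longrightarrow> laurent_eval f q = 0" "laurent_eval f p \<noteq> 0"
  using assms by (auto simp: zariski_closed_def zero_locus_def)

lemma zariski_closed_separating:
  assumes "zariski_closed A" "p \<in> torus" "p \<notin> A"
  obtains P where "vanishes_on P A" "eval2 P p \<noteq> 0"
proof -
  obtain f where f: "\<And>q. q \<in> A \<Longrightarrow> laurent_eval f q = 0" "laurent_eval f p \<noteq> 0"
    using zariski_closed_separating_laurent[OF assms] by blast
  obtain P N where "\<And>p. p \<in> torus \<Longrightarrow> eval2 P p = fst p ^ N * snd p ^ N * laurent_eval f p"
    using ex_eval2_eq_laurent_eval by blast
  then show ?thesis
    using f assms(2) zariski_closed_subset_torus[OF assms(1)]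
    by (intro that[of P]) (auto simp: vanishes_on_def torus_def subset_iff)
qed

text \<open>\<open>Z\<close> is the union of its closed subsets cut out by \<open>P\<close> and by
  \<open>Q\<close>, so it equals one of them: its vanishing ideal is prime.\<close>

lemma zariski_irreducible_vanishes_on_mult:
  assumes Z: "zariski_irreducible Z" and PQ: "vanishes_on (P * Q) Z"
  shows "vanishes_on P Z \<or> vanishes_on Q Z"
proof -
  let ?V = "\<lambda>P. Z \<inter> {p \<in> torus. eval2 P p = 0}"
  have "zariski_closed (?V P)" "zariski_closed (?V Q)"
    using Z by (auto simp: zariski_irreducible_def intro!: zariski_closed_Int zariski_closed_eval2)
  moreover have "Z = ?V P \<union> ?V Q"
    using PQ zariski_irreducible_subset_torus[OF Z] by (auto simp: vanishes_on_def)
  ultimately have "Z = ?V P \<or> Z = ?V Q" using Z unfolding zariski_irreducible_def by blast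
  then show ?thesis unfolding vanishes_on_def by blast
qed

lemma zariski_irreducible_vanishes_on_power:
  assumes Z: "zariski_irreducible Z" and P: "vanishes_on (P ^ n) Z"
  shows "vanishes_on P Z"
  using P
proof (induction n)
  case 0
  then show ?case using Z by (auto simp: vanishes_on_def zariski_irreducible_def)
next
  case (Suc n)
  then show ?case using zariski_irreducible_vanishes_on_mult[OF Z, of P "P ^ n"] by auto
qed

text \<open>Over the complex numbers \<open>r\<close> splits into linear factors, and primality of
  the vanishing ideal selects one of them. So \<open>Z\<close> lies on a line of constant
  \<lambda>.\<close>

lemma zariski_irreducible_vanishes_on_const:
  assumes Z: "zariski_irreducible Z" and "r \<noteq> 0" "vanishes_on [:r:] Z"
  shows "\<exists>c. vanishes_on [:[:- c, 1:]:] Z"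
  using assms(2,3)
proof (induction "degree r" arbitrary: r rule: less_induct)
  case less
  obtain p where p: "p \<in> Z" using Z by (auto simp: zariski_irreducible_def)
  have "degree r \<noteq> 0"
  proof
    assume "degree r = 0"
    then obtain a where "r = [:a:]" by (auto elim: degree_eq_zeroE)
    moreover have "eval2 [:r:] p = 0" using less.prems(2) p unfolding vanishes_on_def by blast
    ultimately show False using less.prems(1) by simp
  qed
  then obtain c where "poly r c = 0" using alg_closed_imp_poly_has_root[of r] by auto
  then obtain s where s: "r = [:- c, 1:] * s" by (auto simp: poly_eq_0_iff_dvd)
  then have s0: "s \<noteq> 0" using less.prems by auto
  have "vanishes_on ([:[:- c, 1:]:] * [:s:]) Z" using less.prems(2) s by (simp add: vanishes_on_def)
  then consider "vanishes_on [:[:- c, 1:]:] Z" | "vanishes_on [:s:] Z"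
    using zariski_irreducible_vanishes_on_mult[OF Z] by blast
  then show ?case
  proof cases
    case 1
    then show ?thesis by blast
  next
    case 2
    have "degree s < degree r" using s0 unfolding s by (subst degree_mult_eq) auto
    then show ?thesis using less.hyps[OF _ s0 2] by blast
  qed
qed

text \<open>Closedness may be tested with ordinary polynomials, since each evaluates like some
  Laurent polynomial.\<close>

lemma zariski_closedI:
  assumes "Z \<subseteq> torus"
    and "\<And>p. p \<in> torus \<Longrightarrow> p \<notin> Z \<Longrightarrow> \<exists>P. vanishes_on P Z \<and> eval2 P p \<noteq> 0"
  shows "zariski_closed Z"
  unfolding zariski_closed_def
proof (rule exI[of _ "{f. \<forall>q\<in>Z. laurent_eval f q = 0}"], intro equalityI subsetI)
  fix p assume p: "p \<in> torus \<inter> (\<Inter>f\<in>{f. \<forall>q\<in>Z. laurent_eval f q = 0}. zero_locus f)"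
  show "p \<in> Z"
  proof (rule ccontr)
    assume "p \<notin> Z"
    then obtain P where P: "vanishes_on P Z" "eval2 P p \<noteq> 0" using assms(2) p by blast
    obtain f where f: "\<And>p. laurent_eval f p = eval2 P p" using ex_laurent_eval_eq_eval2 by blast
    then have "\<forall>q\<in>Z. laurent_eval f q = 0" using P(1) by (simp add: vanishes_on_def)
    then have "laurent_eval f p = 0" using p by (auto simp: zero_locus_def)
    then show False using P(2) f by simp
  qed
qed (use assms(1) in \<open>auto simp: zero_locus_def\<close>)

lemma zariski_closed_Un:
  assumes "zariski_closed A" "zariski_closed B"
  shows "zariski_closed (A \<union> B)"
proof (rule zariski_closedI)
  fix p assume p: "p \<in> torus" "p \<notin> A \<union> B"
  obtain P where "vanishes_on P A" "eval2 P p \<noteq> 0"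
    using zariski_closed_separating assms(1) p by blast
  moreover obtain Q where "vanishes_on Q B" "eval2 Q p \<noteq> 0"
    using zariski_closed_separating assms(2) p by blast
  ultimately show "\<exists>P. vanishes_on P (A \<union> B) \<and> eval2 P p \<noteq> 0"
    by (intro exI[of _ "P * Q"]) (auto simp: vanishes_on_def)
qed (use assms zariski_closed_subset_torus in auto)

lemma zariski_closed_singleton:
  assumes "p \<in> torus"
  shows "zariski_closed {p}"
proof (rule zariski_closedI)
  fix q assume "q \<notin> {p}"
  then consider "fst q \<noteq> fst p" | "snd q \<noteq> snd p" by (auto simp: prod_eq_iff)
  then show "\<exists>P. vanishes_on P {p} \<and> eval2 P q \<noteq> 0"
  proof cases
    case 1
    then show ?thesis by (intro exI[of _ "[:[:- fst p, 1:]:]"]) (simp add: vanishes_on_def)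
  next
    case 2
    then show ?thesis by (intro exI[of _ "[:[:- snd p:], 1:]"]) (simp add: vanishes_on_def eval2_def)
  qed
qed (use assms in auto)

lemma zariski_closed_finite: "finite Z \<Longrightarrow> Z \<noteq> {} \<Longrightarrow> Z \<subseteq> torus \<Longrightarrow> zariski_closed Z"
  by (induction Z rule: finite_ne_induct)
    (auto intro: zariski_closed_singleton zariski_closed_Un[of "{_}", simplified])

lemma zariski_irreducible_finite:
  assumes Z: "zariski_irreducible Z" and fin: "finite Z"
  shows "\<exists>p. Z = {p}"
proof -
  obtain p where p: "p \<in> Z" using Z by (auto simp: zariski_irreducible_def)
  show ?thesis
  proof (cases "Z = {p}")
    case False
    have "zariski_closed {p}" "zariski_closed (Z - {p})"
      using zariski_irreducible_subset_torus[OF Z] p fin False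
      by (auto intro!: zariski_closed_finite)
    moreover have "Z = {p} \<union> (Z - {p})" using p by auto
    ultimately have "Z = {p} \<or> Z = Z - {p}" using Z unfolding zariski_irreducible_def by blast
    then show ?thesis using p by auto
  qed auto
qed

section \<open>Bounding chains of irreducible closed sets in the torus\<close>

text \<open>Pseudo-division by a polynomial of minimal degree in the second variable replaces
  the resultant of two polynomials without common factor.\<close>

lemma proper_subset_vanishes_on_const:
  assumes Z: "zariski_irreducible Z" and Y: "zariski_irreducible Y" and YZ: "Y \<subset> Z"
    and f: "f \<noteq> 0" "vanishes_on f Z"
  obtains c where "vanishes_on [:[:- c, 1:]:] Y"
proof (rule ccontr)
  assume neg: "\<not> thesis"
  note thesisI = that
  \<comment> \<open>Under the negated claim no nonzero polynomial in \<lambda> alone vanishes on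
    \<open>Y\<close>, as one of its linear factors would vanish there too.\<close>
  have const: "\<not> vanishes_on P Y" if "P \<noteq> 0" "degree P = 0" for P
  proof -
    obtain r where "P = [:r:]" using \<open>degree P = 0\<close> by (auto elim: degree_eq_zeroE)
    then show ?thesis
      using zariski_irreducible_vanishes_on_const[OF Y, of r] \<open>P \<noteq> 0\<close> neg thesisI by auto
  qed
  \<comment> \<open>Pseudo-division introduces powers of leading coefficients, which are polynomials
    in \<lambda>. By \<open>const\<close> they do not vanish on \<open>Y\<close>, hence not on
    \<open>W\<close>, and primality cancels them.\<close>
  have scale: "vanishes_on P W"
    if "vanishes_on (smult (a ^ n) P) W" "zariski_irreducible W" "Y \<subseteq> W" "a \<noteq> 0" for a n P W
  proof -
    have "vanishes_on ([:a:] ^ n * P) W" using that(1) by (simp add: vanishes_on_def)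
    then consider "vanishes_on [:a:] W" | "vanishes_on P W"
      using zariski_irreducible_vanishes_on_mult[OF \<open>zariski_irreducible W\<close>, of "[:a:] ^ n" P]
        zariski_irreducible_vanishes_on_power[OF \<open>zariski_irreducible W\<close>, of "[:a:]" n] by blast
    then show ?thesis using const[of "[:a:]"] vanishes_on_mono[OF _ that(3)] that(4) by cases auto
  qed
  \<comment> \<open>\<open>g\<close> has minimal degree in \<mu> among the nonzero polynomials that
    vanish on \<open>Z\<close>; \<open>r\<close> below has minimal degree among those that vanish on
    \<open>Y\<close> but not on \<open>Z\<close>.\<close>
  obtain g where g: "vanishes_on g Z" "g \<noteq> 0"
    and gmin: "\<And>h. vanishes_on h Z \<Longrightarrow> h \<noteq> 0 \<Longrightarrow> degree g \<le> degree h"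
    using ex_has_least_nat[of "\<lambda>h. vanishes_on h Z \<and> h \<noteq> 0" f degree] f by auto
  have ex: "\<exists>h. vanishes_on h Y \<and> \<not> vanishes_on h Z"
  proof -
    obtain p where p: "p \<in> Z" "p \<notin> Y" using YZ by blast
    then obtain h where "vanishes_on h Y" "eval2 h p \<noteq> 0"
      using zariski_closed_separating[of Y p] Y zariski_irreducible_subset_torus[OF Z]
      by (auto simp: zariski_irreducible_def)
    then show ?thesis using p by (auto simp: vanishes_on_def)
  qed
  then obtain h where h: "vanishes_on h Y \<and> \<not> vanishes_on h Z" by blast
  obtain r where r: "vanishes_on r Y" "\<not> vanishes_on r Z"
    and rmin: "\<And>h. vanishes_on h Y \<Longrightarrow> \<not> vanishes_on h Z \<Longrightarrow> degree r \<le> degree h"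
    using ex_has_least_nat[of "\<lambda>h. vanishes_on h Y \<and> \<not> vanishes_on h Z" h degree, OF h] by auto
  have r0: "r \<noteq> 0" using r by (auto simp: vanishes_on_def)
  have gY: "vanishes_on g Y" using g YZ by (auto intro: vanishes_on_mono)
  \<comment> \<open>The pseudo-remainder of \<open>r\<close> modulo \<open>g\<close> again vanishes
    on \<open>Y\<close> and not on \<open>Z\<close>, so minimality of \<open>r\<close> bounds
    \<open>degree r\<close> by its degree.\<close>
  have deg_r: "degree r < degree g"
  proof -
    obtain q s where qs: "pseudo_divmod r g = (q, s)" by force
    note pd = pseudo_divmod[OF g(2) qs]
    let ?c = "coeff g (degree g)" and ?n = "Suc (degree r) - degree g"
    have "s = smult (?c ^ ?n) r - g * q" using pd(1) by simp
    then have e: "eval2 s p = eval2 (smult (?c ^ ?n) r) p - eval2 g p * eval2 q p" for p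
      by (simp only: eval2_simps)
    have sY: "vanishes_on s Y" using r(1) gY unfolding vanishes_on_def e by auto
    moreover have sZ: "\<not> vanishes_on s Z"
    proof
      assume "vanishes_on s Z"
      then have "vanishes_on (smult (?c ^ ?n) r) Z" using g(1) e unfolding vanishes_on_def by auto
      then have "vanishes_on r Z" using scale Z YZ g(2) by auto
      then show False using r(2) by simp
    qed
    moreover have "s \<noteq> 0" using sZ by (auto simp: vanishes_on_def)
    ultimately show ?thesis using rmin[OF sY sZ] pd(2) by auto
  qed
  \<comment> \<open>Now \<open>g\<close> is divided by \<open>r\<close>. A nonzero remainder, having
    degree below \<open>r\<close>, would vanish on \<open>Z\<close> by minimality of
    \<open>r\<close>, against minimality of \<open>g\<close>.\<close>
  obtain q s where qs: "pseudo_divmod g r = (q, s)" by force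
  note pd = pseudo_divmod[OF r0 qs]
  let ?c = "coeff r (degree r)" and ?n = "Suc (degree g) - degree r"
  have "s = smult (?c ^ ?n) g - r * q" using pd(1) by simp
  then have e: "eval2 s p = eval2 (smult (?c ^ ?n) g) p - eval2 r p * eval2 q p" for p
    by (simp only: eval2_simps)
  have sY: "vanishes_on s Y" using r(1) gY unfolding vanishes_on_def e by auto
  have s0: "s = 0"
  proof (rule ccontr)
    assume "s \<noteq> 0"
    then have d: "degree s < degree r" using pd(2) by auto
    then have "vanishes_on s Z" using rmin[OF sY] by force
    then show False using gmin[of s] \<open>s \<noteq> 0\<close> d deg_r by auto
  qed
  then have eq: "smult (?c ^ ?n) g = r * q" using pd(1) by simp
  have "vanishes_on (r * q) Z" unfolding eq[symmetric] using g(1) by (auto simp: vanishes_on_def)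
  \<comment> \<open>Since \<open>r\<close> does not vanish on \<open>Z\<close>, the quotient does;
    its degree is then at least that of \<open>g\<close>, which leaves degree 0 for
    \<open>r\<close>.\<close>
  then have qZ: "vanishes_on q Z" using zariski_irreducible_vanishes_on_mult[OF Z] r(2) by blast
  have "smult (?c ^ ?n) g \<noteq> 0" using g(2) r0 by simp
  then have q0: "q \<noteq> 0" unfolding eq by auto
  have "degree g = degree r + degree q"
    using degree_mult_eq[OF r0 q0] r0 unfolding eq[symmetric] by simp
  moreover have "degree g \<le> degree q" using gmin[OF qZ q0] .
  ultimately have "degree r = 0" by simp
  then show False using const[OF r0] r(1) by simp
qed

text \<open>A polynomial that vanishes on \<open>Y\<close> but not on the whole line \<lambda> = c
  leaves finitely many points. If the line contains \<open>Z\<close>, a polynomial separating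
  \<open>Y\<close> from a point of \<open>Z\<close> serves, since a multiple of \<lambda> - c would
  vanish at that point. If not, \<open>f\<close> serves once its factors \<lambda> - c are
  cancelled.\<close>

lemma zariski_irreducible_subset_line:
  assumes Z: "zariski_irreducible Z" and Y: "zariski_irreducible Y" and YZ: "Y \<subset> Z"
    and c: "vanishes_on [:[:- c, 1:]:] Y" and f: "f \<noteq> 0" "vanishes_on f Z"
  shows "finite Y"
proof -
  have fst: "fst p = c" if "p \<in> Y" for p using c that by (auto simp: vanishes_on_def)
  have fin: "finite Y" if h: "vanishes_on h Y" "map_poly (\<lambda>a. poly a c) h \<noteq> 0" for h
  proof -
    have "poly (map_poly (\<lambda>a. poly a c) h) y = eval2 h (c, y)" for y
      unfolding eval2_def by (induction h) (simp_all add: map_poly_pCons)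
    then have "Y \<subseteq> (\<lambda>y. (c, y)) ` {y. poly (map_poly (\<lambda>a. poly a c) h) y = 0}"
      using h(1) fst by (force simp: vanishes_on_def image_iff)
    then show ?thesis using poly_roots_finite[OF h(2)] finite_subset by blast
  qed
  have dvd: "\<exists>h'. h = [:[:- c, 1:]:] * h'" if "map_poly (\<lambda>a. poly a c) h = 0" for h
  proof -
    have "poly (coeff h n) c = 0" for n
      using arg_cong[OF that, of "\<lambda>h. coeff h n"] by (simp add: coeff_map_poly)
    then have "[:[:- c, 1:]:] dvd h" by (simp add: const_poly_dvd_iff poly_eq_0_iff_dvd)
    then show ?thesis unfolding dvd_def .
  qed
  show ?thesis
  proof (cases "vanishes_on [:[:- c, 1:]:] Z")
    case True
    obtain p where p: "p \<in> Z" "p \<notin> Y" using YZ by blast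
    then obtain h where h: "vanishes_on h Y" "eval2 h p \<noteq> 0"
      using zariski_closed_separating[of Y p] Y zariski_irreducible_subset_torus[OF Z]
      by (auto simp: zariski_irreducible_def)
    have "map_poly (\<lambda>a. poly a c) h \<noteq> 0"
    proof
      assume "map_poly (\<lambda>a. poly a c) h = 0"
      then obtain h' where "h = [:[:- c, 1:]:] * h'" using dvd by blast
      then show False using h(2) p(1) True by (auto simp: vanishes_on_def simp del: mult_pCons_left)
    qed
    then show ?thesis using fin h(1) by blast
  next
    case False
    from f show ?thesis
    \<comment> \<open>Cancelling \<lambda> - c lowers the degree in \<lambda> of the leading
      coefficient, so the process ends.\<close>
    proof (induction "degree (lead_coeff f)" arbitrary: f rule: less_induct)
      case less
      show ?case
      proof (cases "map_poly (\<lambda>a. poly a c) f = 0")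
        case True
        then obtain h where h: "f = [:[:- c, 1:]:] * h" using dvd by blast
        then have h0: "h \<noteq> 0" using less.prems by auto
        have "vanishes_on h Z"
          using less.prems(2) False zariski_irreducible_vanishes_on_mult[OF Z] unfolding h by blast
        moreover have "lead_coeff f = [:- c, 1:] * lead_coeff h"
          unfolding h by (subst lead_coeff_mult) simp
        then have "degree (lead_coeff h) < degree (lead_coeff f)"
          using h0 by (simp add: degree_mult_eq del: mult_pCons_left)
        ultimately show ?thesis using less.hyps h0 by blast
      next
        case False
        then show ?thesis using fin vanishes_on_mono[OF less.prems(2)] YZ by blast
      qed
    qed
  qed
qed

text \<open>A nonzero polynomial vanishing on \<open>Z\<close> confines \<open>Y\<close> to a line,
  where \<open>Y\<close> is finite and thus a single point, with no room for a nonempty proper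
  subset.\<close>

lemma zariski_chain_length:
  assumes "zariski_irreducible X" "zariski_irreducible Y" "zariski_irreducible Z"
    and "X \<subset> Y" "Y \<subset> Z" "Z \<subset> torus"
  shows False
proof -
  obtain p where p: "p \<in> torus" "p \<notin> Z" using assms(6) by blast
  obtain f where f: "vanishes_on f Z" "eval2 f p \<noteq> 0"
    using zariski_closed_separating[of Z p] assms(3) p by (auto simp: zariski_irreducible_def)
  then have f0: "f \<noteq> 0" by auto
  obtain c where c: "vanishes_on [:[:- c, 1:]:] Y"
    using proper_subset_vanishes_on_const[OF assms(3,2,5) f0 f(1)] by blast
  have "finite Y" using zariski_irreducible_subset_line[OF assms(3,2,5) c f0 f(1)] .
  then obtain q where "Y = {q}" using zariski_irreducible_finite assms(2) by blast
  then show False using assms(1,4) by (auto simp: zariski_irreducible_def)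
qed

subsection \<open>The curve \<open>\<lambda> \<mu>\<^sup>N = 1\<close>\<close>

definition slope_curve :: "int \<Rightarrow> (complex \<times> complex) set" where
  "slope_curve N = {p \<in> torus. fst p * snd p powi N = 1}"

lemma slope_curve_altdef: "slope_curve N = (\<lambda>y. (y powi (- N), y)) ` (UNIV - {0})"
proof (intro equalityI subsetI)
  fix p assume "p \<in> slope_curve N"
  then show "p \<in> (\<lambda>y. (y powi (- N), y)) ` (UNIV - {0})"
    by (intro image_eqI[of _ _ "snd p"])
      (auto simp: slope_curve_def torus_def prod_eq_iff power_int_minus field_simps)
qed (auto simp: slope_curve_def torus_def power_int_minus field_simps)

lemma infinite_slope_curve: "infinite (slope_curve N)"
proof -
  have "infinite (UNIV - {0 :: complex})" by (simp add: infinite_UNIV_char_0)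
  then show ?thesis
    unfolding slope_curve_altdef by (subst finite_image_iff) (auto intro: inj_onI)
qed

lemma one_minus_dvd_one_minus_power:
  fixes t :: "'a :: comm_ring_1"
  shows "1 - t dvd 1 - t ^ n"
proof (induction n)
  case (Suc n)
  have "1 - t ^ Suc n = (1 - t) + t * (1 - t ^ n)" by (simp add: algebra_simps)
  then show ?case using Suc by (metis dvd_add dvd_mult dvd_refl)
qed simp

text \<open>Modulo 1 - T with T = \<lambda> \<mu>^N, the variable \<lambda> equals \<mu>^(-N). The
  difference is a multiple of 1 - T^i or of 1 - T^(-i), whichever exponent is nonnegative.\<close>

lemma one_minus_single_dvd_diff:
  "1 - Poly_Mapping.single (1, N) 1 dvd
    Poly_Mapping.single (i, j) c - Poly_Mapping.single (0 :: int, j - N * i) (c :: complex)"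
proof -
  let ?T = "Poly_Mapping.single (1 :: int, N) (1 :: complex)"
  have pow: "?T ^ n = Poly_Mapping.single (int n, N * int n) 1" for n
    by (induction n) (auto simp: mult_single algebra_simps simp flip: single_one zero_prod_def)
  show ?thesis
  proof (cases "i \<ge> 0")
    case True
    have "Poly_Mapping.single (i, j) c - Poly_Mapping.single (0, j - N * i) c =
        (1 - ?T ^ nat i) * (- Poly_Mapping.single (0, j - N * i) c)"
      using True by (simp add: pow mult_single algebra_simps)
    then show ?thesis by (metis one_minus_dvd_one_minus_power dvd_mult2)
  next
    case False
    have "Poly_Mapping.single (i, j) c - Poly_Mapping.single (0, j - N * i) c =
        (1 - ?T ^ nat (- i)) * Poly_Mapping.single (i, j) c"
      using False by (simp add: pow mult_single algebra_simps)
    then show ?thesis by (metis one_minus_dvd_one_minus_power dvd_mult2)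
  qed
qed

text \<open>Modulo \<open>1 - \<lambda> \<mu>\<^sup>N\<close> every Laurent polynomial is congruent to one in \<open>\<mu>\<close> alone.\<close>

lemma vanishes_on_slope_curve:
  assumes inf: "infinite {p \<in> slope_curve N. laurent_eval f p = 0}"
  shows "1 - Poly_Mapping.single (1, N) 1 dvd f"
    and "p \<in> slope_curve N \<Longrightarrow> laurent_eval f p = 0"
proof -
  \<comment> \<open>The reduction of \<open>f\<close>, with \<lambda> replaced by
    \<mu>^(-N).\<close>
  define g where "g = (\<Sum>(i, j)\<in>Poly_Mapping.keys f.
    Poly_Mapping.single (0 :: int, j - N * i) (Poly_Mapping.lookup f (i, j)))"
  have g: "laurent_eval g (x, y) = laurent_eval f (y powi (- N), y)" if "y \<noteq> 0" for x y
    unfolding g_def laurent_eval_sum laurent_eval_def[of f] case_prod_unfold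
    by (intro sum.cong refl)
      (use that in \<open>simp add: laurent_eval_single power_int_diff power_int_mult power_int_minus
        power_int_inverse field_simps\<close>)
  obtain P M where P: "\<And>p. p \<in> torus \<Longrightarrow> eval2 P p = fst p ^ M * snd p ^ M * laurent_eval g p"
    and g0: "P = 0 \<Longrightarrow> g = 0"
    using ex_eval2_eq_laurent_eval[of g] by blast
  define Y where "Y = {y. y \<noteq> 0 \<and> laurent_eval f (y powi (- N), y) = 0}"
  have "{p \<in> slope_curve N. laurent_eval f p = 0} = (\<lambda>y. (y powi (- N), y)) ` Y"
    unfolding slope_curve_altdef Y_def by auto
  then have Y: "infinite Y" using inf by auto
  \<comment> \<open>The value of \<open>g\<close> does not depend on the first coordinate, so
    \<open>P\<close> vanishes on the whole grid of nonzero \<open>x\<close> and of \<open>y\<close>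
    in \<open>Y\<close>, a product of two infinite sets.\<close>
  have "infinite (UNIV - {0 :: complex})" by (simp add: infinite_UNIV_char_0)
  moreover have "eval2 P (x, y) = 0" if "x \<in> UNIV - {0}" "y \<in> Y" for x y
    using that P[of "(x, y)"] by (simp add: Y_def torus_def g)
  ultimately have "P = 0" using eval2_eq_0[OF _ Y] by blast
  then have "g = 0" by (rule g0)
  have "f - g = (\<Sum>x\<in>Poly_Mapping.keys f. Poly_Mapping.single x (Poly_Mapping.lookup f x) -
      Poly_Mapping.single (0, snd x - N * fst x) (Poly_Mapping.lookup f x))"
    by (simp add: g_def sum_subtractf sum_single_lookup case_prod_unfold)
  then have "1 - Poly_Mapping.single (1, N) 1 dvd f - g"
    by (metis (no_types, lifting) dvd_sum one_minus_single_dvd_diff prod.collapse)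
  then show "1 - Poly_Mapping.single (1, N) 1 dvd f" using \<open>g = 0\<close> by simp
  show "laurent_eval f p = 0" if "p \<in> slope_curve N"
    using that g \<open>g = 0\<close> by (auto simp: slope_curve_altdef)
qed

text \<open>A Laurent polynomial with infinitely many zeros on the curve vanishes on all of it. This
  gives both the irreducibility of the curve and its inclusion in the closure of the eigenvalue
  pairs.\<close>

lemma slope_curve_subset:
  assumes "zariski_closed A" "infinite (A \<inter> slope_curve N)"
  shows "slope_curve N \<subseteq> A"
proof (rule ccontr)
  assume "\<not> slope_curve N \<subseteq> A"
  then obtain p where p: "p \<in> slope_curve N" "p \<notin> A" by blast
  then obtain f where f: "\<And>q. q \<in> A \<Longrightarrow> laurent_eval f q = 0" "laurent_eval f p \<noteq> 0"
    using zariski_closed_separating_laurent[OF assms(1), of p] by (auto simp: slope_curve_def)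
  have "A \<inter> slope_curve N \<subseteq> {p \<in> slope_curve N. laurent_eval f p = 0}" using f by blast
  then have "infinite {p \<in> slope_curve N. laurent_eval f p = 0}"
    using assms(2) finite_subset by blast
  then show False using vanishes_on_slope_curve(2) p(1) f(2) by blast
qed

lemma laurent_eval_1 [simp]: "laurent_eval 1 p = 1"
  using laurent_eval_single[of 0 0 1 p] by (simp flip: zero_prod_def)

lemma zariski_closed_slope_curve: "zariski_closed (slope_curve N)"
proof -
  have "slope_curve N = zero_locus (1 - Poly_Mapping.single (1, N) 1)"
    by (auto simp: slope_curve_def zero_locus_def laurent_eval_diff laurent_eval_single)
  then show ?thesis by (simp add: zariski_closed_zero_locus)
qed

lemma zariski_irreducible_slope_curve: "zariski_irreducible (slope_curve N)"
  unfolding zariski_irreducible_def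
proof (intro conjI allI impI)
  show "slope_curve N \<noteq> {}" using infinite_slope_curve[of N] by auto
  fix A B assume AB: "zariski_closed A \<and> zariski_closed B \<and> slope_curve N = A \<union> B"
  then have "infinite A \<or> infinite B" using infinite_slope_curve[of N] by auto
  then have "infinite (A \<inter> slope_curve N) \<or> infinite (B \<inter> slope_curve N)"
    using AB by (metis Int_Un_eq(1) Int_absorb2 Un_upper1 Un_upper2)
  then show "slope_curve N = A \<or> slope_curve N = B" using slope_curve_subset AB by blast
qed (rule zariski_closed_slope_curve)

lemma zariski_irreducible_torus: "zariski_irreducible torus"
  unfolding zariski_irreducible_def
proof (intro conjI allI impI)
  show "torus \<noteq> {}" by (auto simp: torus_def intro: exI[of _ 1])
  fix A B assume AB: "zariski_closed A \<and> zariski_closed B \<and> torus = A \<union> B"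
  show "torus = A \<or> torus = B"
  proof (rule ccontr)
    assume "\<not> (torus = A \<or> torus = B)"
    then obtain p q where pq: "p \<in> torus" "p \<notin> A" "q \<in> torus" "q \<notin> B" using AB by blast
    obtain P where P: "vanishes_on P A" "eval2 P p \<noteq> 0"
      using zariski_closed_separating AB pq by blast
    obtain Q where Q: "vanishes_on Q B" "eval2 Q q \<noteq> 0"
      using zariski_closed_separating AB pq by blast
    have inf: "infinite (UNIV - {0 :: complex})" by (simp add: infinite_UNIV_char_0)
    have "P * Q = 0"
    proof (rule eval2_eq_0[OF inf inf])
      fix x y :: complex assume "x \<in> UNIV - {0}" "y \<in> UNIV - {0}"
      then have "(x, y) \<in> A \<union> B" using AB by (auto simp: torus_def)
      then show "eval2 (P * Q) (x, y) = 0" using P(1) Q(1) by (auto simp: vanishes_on_def)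
    qed
    then show False using P(2) Q(2) by auto
  qed
qed simp

section \<open>Dimensions of the torus and of the curve\<close>

lemma zariski_irreducible_singleton: "p \<in> torus \<Longrightarrow> zariski_irreducible {p}"
  unfolding zariski_irreducible_def using zariski_closed_singleton by blast

lemma slope_curve_psubset_torus: "slope_curve N \<subset> torus"
proof -
  have "(2, 1) \<in> torus" "(2, 1) \<notin> slope_curve N" by (auto simp: torus_def slope_curve_def)
  moreover have "slope_curve N \<subseteq> torus" by (auto simp: slope_curve_def)
  ultimately show ?thesis by blast
qed

lemma singleton_psubset_slope_curve: "{(1, 1)} \<subset> slope_curve N"
proof -
  have "(1, 1) \<in> slope_curve N" by (auto simp: torus_def slope_curve_def)
  moreover have "slope_curve N \<noteq> {(1, 1)}" using infinite_slope_curve[of N] by auto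
  ultimately show ?thesis by blast
qed

text \<open>A chain longer than \<open>d\<close> starts with a chain of length \<open>d + 1\<close>,
  so only that length has to be excluded.\<close>

lemma zariski_dim_eqI:
  assumes "\<forall>i\<le>d. zariski_irreducible (C i) \<and> C i \<subseteq> X" "\<forall>i<d. C i \<subset> C (Suc i)"
    and "\<And>C. \<forall>i\<le>Suc d. zariski_irreducible (C i) \<and> C i \<subseteq> X \<Longrightarrow> \<forall>i<Suc d. C i \<subset> C (Suc i) \<Longrightarrow> False"
  shows "zariski_dim X = enat d"
  unfolding zariski_dim_def
proof (rule cSup_eq_maximum)
  show "enat d \<in> {enat d |d. \<exists>C. (\<forall>i\<le>d. zariski_irreducible (C i) \<and> C i \<subseteq> X) \<and> (\<forall>i<d. C i \<subset> C (Suc i))}"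
    using assms(1,2) by blast
  fix x assume "x \<in> {enat d |d. \<exists>C. (\<forall>i\<le>d. zariski_irreducible (C i) \<and> C i \<subseteq> X) \<and> (\<forall>i<d. C i \<subset> C (Suc i))}"
  then obtain e C where e: "x = enat e" "\<forall>i\<le>e. zariski_irreducible (C i) \<and> C i \<subseteq> X"
      "\<forall>i<e. C i \<subset> C (Suc i)"
    by blast
  have "e \<le> d"
  proof (rule ccontr)
    assume "\<not> e \<le> d"
    then show False using assms(3)[of C] e(2,3) by auto
  qed
  then show "x \<le> enat d" using e(1) by simp
qed

lemma zariski_dim_torus: "zariski_dim torus = 2"
proof -
  have "zariski_dim torus = enat 2"
  \<comment> \<open>\<open>slope_curve 0\<close> is the line \<lambda> = 1 through (1, 1).\<close>
  proof (rule zariski_dim_eqI[of _ "\<lambda>i. if i = 0 then {(1, 1)} else if i = 1 then slope_curve 0 else torus"],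
      goal_cases)
    case 1
    then show ?case
      using zariski_irreducible_singleton[of "(1, 1)"] zariski_irreducible_slope_curve[of 0]
        zariski_irreducible_torus slope_curve_psubset_torus[of 0]
      by (auto simp: torus_def)
  next
    case 2
    then show ?case
      using slope_curve_psubset_torus[of 0] singleton_psubset_slope_curve[of 0]
      by (auto simp: less_2_cases_iff)
  next
    case (3 C)
    have "C 0 \<subset> C 1" "C 1 \<subset> C 2" "C 2 \<subset> C 3"
      using 3(2)[rule_format, of 0] 3(2)[rule_format, of 1] 3(2)[rule_format, of 2]
      by (simp_all add: numeral_2_eq_2 numeral_3_eq_3)
    moreover have "zariski_irreducible (C 0)" "zariski_irreducible (C 1)" "zariski_irreducible (C 2)"
        "C 3 \<subseteq> torus"
      using 3(1) by auto
    ultimately show ?case using zariski_chain_length[of "C 0" "C 1" "C 2"] by blast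
  qed
  then show ?thesis by (simp add: numeral_eq_enat)
qed

lemma zariski_dim_slope_curve: "zariski_dim (slope_curve N) = 1"
proof -
  have "zariski_dim (slope_curve N) = enat 1"
  proof (rule zariski_dim_eqI[of _ "\<lambda>i. if i = 0 then {(1, 1)} else slope_curve N"], goal_cases)
    case 1
    then show ?case
      using zariski_irreducible_singleton[of "(1, 1)"] zariski_irreducible_slope_curve[of N]
        singleton_psubset_slope_curve[of N]
      by (auto simp: torus_def)
  next
    case 2
    then show ?case using singleton_psubset_slope_curve[of N] by auto
  next
    case (3 C)
    have "C 0 \<subset> C 1" "C 1 \<subset> C 2"
      using 3(2)[rule_format, of 0] 3(2)[rule_format, of 1]
      by (simp_all add: numeral_2_eq_2)
    moreover have "zariski_irreducible (C 0)" "zariski_irreducible (C 1)" "zariski_irreducible (C 2)"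
        "C 2 \<subseteq> slope_curve N"
      using 3(1) by auto
    ultimately show ?case
      using zariski_chain_length[of "C 0" "C 1" "C 2"] slope_curve_psubset_torus[of N] by blast
  qed
  then show ?thesis by (simp add: one_enat_def)
qed

section \<open>The curve as a component of the closure\<close>

lemma irreducible_component_slope_curve:
  assumes "slope_curve N \<subseteq> V" and "\<nexists>Z. irreducible_component Z V \<and> zariski_dim Z = 2"
  shows "irreducible_component (slope_curve N) V"
  unfolding irreducible_component_def
proof (intro conjI allI impI)
  fix Z assume Z: "zariski_irreducible Z \<and> slope_curve N \<subseteq> Z \<and> Z \<subseteq> V"
  have sub: "Z \<subseteq> torus" using Z zariski_irreducible_subset_torus by blast
  show "Z = slope_curve N"
  proof (rule ccontr)
    assume "Z \<noteq> slope_curve N"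
    then have ss: "slope_curve N \<subset> Z" using Z by blast
    \<comment> \<open>Otherwise the point (1, 1), the curve, \<open>Z\<close> and the torus would
      form a strict chain of four irreducible sets.\<close>
    have "Z = torus"
    proof (rule ccontr)
      assume "Z \<noteq> torus"
      then show False
        using zariski_chain_length[OF _ _ _ singleton_psubset_slope_curve ss] sub Z
          zariski_irreducible_slope_curve zariski_irreducible_singleton[of "(1, 1)"]
        by (auto simp: torus_def)
    qed
    then have "irreducible_component torus V"
      using Z zariski_irreducible_subset_torus unfolding irreducible_component_def by blast
    then show False using assms(2) zariski_dim_torus by blast
  qed
qed (use assms zariski_irreducible_slope_curve in auto)

text \<open>The curve lies in every closed set containing the eigenvalue pairs, so it is a
  one-dimensional component of the closure and lies in the zero locus of \<open>A\<close>; vanishing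
  on the curve gives divisibility.\<close>

lemma slope_polynomial_dvd_A_polynomial:
  assumes A: "is_A_polynomial k n A" and inf: "infinite (KCH_eigenvalues k n \<inter> slope_curve N)"
  shows "1 - Poly_Mapping.single (1, N) 1 dvd A"
proof -
  define V where "V = zariski_closed hull KCH_eigenvalues k n"
  note A' = A[unfolded is_A_polynomial_def Let_def V_def[symmetric]]
  have "slope_curve N \<subseteq> V"
    unfolding V_def hull_def
  proof (intro Inter_greatest)
    fix T assume T: "T \<in> {T. zariski_closed T \<and> KCH_eigenvalues k n \<subseteq> T}"
    then have "KCH_eigenvalues k n \<inter> slope_curve N \<subseteq> T \<inter> slope_curve N" by blast
    then have "infinite (T \<inter> slope_curve N)" using inf finite_subset by blast
    then show "slope_curve N \<subseteq> T" using slope_curve_subset T by blast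
  qed
  then have "irreducible_component (slope_curve N) V"
    using irreducible_component_slope_curve A' by blast
  then have "slope_curve N \<subseteq> zero_locus A"
    using A' zariski_dim_slope_curve[of N] by blast
  then have "{p \<in> slope_curve N. laurent_eval A p = 0} = slope_curve N"
    by (auto simp: zero_locus_def)
  then show ?thesis using vanishes_on_slope_curve(1) infinite_slope_curve by metis
qed

subsection \<open>Homomorphisms from presented groups\<close>

definition word_eval :: "('a, 'b) monoid_scheme \<Rightarrow> ('g \<Rightarrow> 'a) \<Rightarrow> 'g word \<Rightarrow> 'a" where
  "word_eval G f u =
    foldr (\<lambda>(x, b) y. (if b then inv\<^bsub>G\<^esub> f x else f x) \<otimes>\<^bsub>G\<^esub> y) u \<one>\<^bsub>G\<^esub>"

context group
begin

lemma word_eval_Nil [simp]: "word_eval G f [] = \<one>"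
  by (simp add: word_eval_def)

lemma word_eval_Cons [simp]:
  "word_eval G f ((x, b) # u) = (if b then inv f x else f x) \<otimes> word_eval G f u"
  by (simp add: word_eval_def)

lemma word_eval_closed [intro]: "(\<And>x. f x \<in> carrier G) \<Longrightarrow> word_eval G f u \<in> carrier G"
  by (induction u) auto

lemma word_eval_append:
  assumes "\<And>x. f x \<in> carrier G"
  shows "word_eval G f (u @ v) = word_eval G f u \<otimes> word_eval G f v"
proof (induction u)
  case Nil
  show ?case by (simp add: assms word_eval_closed)
next
  case (Cons a u)
  obtain x b where a: "a = (x, b)" by force
  show ?case using Cons assms by (simp add: a m_assoc word_eval_closed)
qed

lemma word_eval_pres_eq:
  assumes f: "\<And>x. f x \<in> carrier G"
    and R: "\<And>u v. (u, v) \<in> R \<Longrightarrow> word_eval G f u = word_eval G f v"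
    and "pres_eq R u v"
  shows "word_eval G f u = word_eval G f v"
  using assms(3)
proof induction
  case (pres_cancel x b)
  show ?case by (simp add: f)
qed (simp_all add: R word_eval_append[OF f])

text \<open>The universal property of a presentation: a class is evaluated on a chosen
  representative, and invariance under \<open>pres_eq\<close> makes the choice immaterial.\<close>

lemma presented_group_hom:
  assumes f: "\<And>x. f x \<in> carrier G"
    and R: "\<And>u v. (u, v) \<in> R \<Longrightarrow> word_eval G f u = word_eval G f v"
  obtains \<rho> where "\<rho> \<in> hom (presented_group R) G" "\<And>u. \<rho> (pres_class R u) = word_eval G f u"
proof -
  define \<rho> where "\<rho> A = word_eval G f (SOME u. pres_class R u = A)" for A
  have \<rho>: "\<rho> (pres_class R u) = word_eval G f u" for u
  proof -
    have "pres_class R (SOME v. pres_class R v = pres_class R u) = pres_class R u"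
      by (rule someI) (rule refl)
    then have e: "pres_eq R (SOME v. pres_class R v = pres_class R u) u"
      by (rule pres_class_eq_iff[THEN iffD1])
    show ?thesis unfolding \<rho>_def by (rule word_eval_pres_eq[of f R, OF f R e])
  qed
  have "\<rho> \<in> hom (presented_group R) G"
  proof (rule homI)
    fix A assume "A \<in> carrier (presented_group R)"
    then obtain u where u: "A = pres_class R u" by (auto simp: presented_group_def)
    show "\<rho> A \<in> carrier G" by (simp add: u \<rho> word_eval_closed[OF f])
    fix B assume "B \<in> carrier (presented_group R)"
    then obtain v where v: "B = pres_class R v" by (auto simp: presented_group_def)
    show "\<rho> (A \<otimes>\<^bsub>presented_group R\<^esub> B) = \<rho> A \<otimes> \<rho> B"
      by (simp add: u v presented_group_mult \<rho> word_eval_append[OF f])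
  qed
  then show thesis using \<rho> by (rule that)
qed

lemma word_eval_letter: "(\<And>x. f x \<in> carrier G) \<Longrightarrow> word_eval G f (letter x) = f x"
  by (simp add: letter_def)

lemma word_eval_word_inv:
  assumes f: "\<And>x. f x \<in> carrier G"
  shows "word_eval G f (word_inv u) = inv word_eval G f u"
proof -
  \<comment> \<open>Free cancellation suffices, so \<open>pres_inverse\<close> is taken for the
    empty set of relations.\<close>
  have "word_eval G f (word_inv u) \<otimes> word_eval G f u = word_eval G f []"
    unfolding word_eval_append[OF f, symmetric]
    by (rule word_eval_pres_eq[OF f _ pres_inverse[of "{}"]]) auto
  also have "\<dots> = \<one>" by simp
  finally show ?thesis by (intro inv_equality[symmetric] word_eval_closed[OF f])
qed

lemma word_eval_word_pow:
  assumes f: "\<And>x. f x \<in> carrier G"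
  shows "word_eval G f (word_pow u i) = word_eval G f u [^] i"
proof -
  note cl = word_eval_closed[of f, OF f]
  have pow: "word_eval G f (concat (replicate n v)) = word_eval G f v [^] n" for n :: nat and v
  proof (induction n)
    case 0
    show ?case by simp
  next
    case (Suc n)
    have "word_eval G f (concat (replicate (Suc n) v)) = word_eval G f v \<otimes> word_eval G f v [^] n"
      by (simp add: word_eval_append[OF f] Suc del: nat_pow_Suc)
    also have "\<dots> = word_eval G f v [^] Suc n" by (rule nat_pow_Suc2[OF cl, symmetric])
    finally show ?case .
  qed
  show ?thesis
  proof (cases "i < 0")
    case True
    then have "word_eval G f (word_pow u i) = (inv word_eval G f u) [^] nat (- i)"
      by (simp add: word_pow_def pow word_eval_word_inv[OF f])
    then show ?thesis using True by (simp only: int_pow_def2 nat_pow_inv[OF cl] if_True)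
  next
    case False
    then have "word_eval G f (word_pow u i) = word_eval G f u [^] nat i"
      by (simp add: word_pow_def pow)
    then show ?thesis using False by (simp only: int_pow_def2 if_False)
  qed
qed

text \<open>Serves to compute integer powers inside an explicit one-parameter family, namely the
  diagonal matrices \<open>W\<close> below.\<close>

lemma int_pow_eq_additive:
  fixes D :: "int \<Rightarrow> 'a" and n :: int
  assumes D: "\<And>n. D n \<in> carrier G" "\<And>m n. D (m + n) = D m \<otimes> D n"
  shows "D 1 [^] n = D n"
proof -
  have D0: "D 0 = \<one>" using D(1)[of 0] D(2)[of 0 0] by (metis add_0 l_cancel_one)
  have nat: "D 1 [^] n = D (int n)" for n :: nat
    by (induction n) (simp_all add: D0 D(2)[symmetric] add.commute)
  have "inv (D (- n)) = D n"
    by (rule inv_equality) (simp_all add: D0 D(1) flip: D(2))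
  then show ?thesis by (cases "n < 0") (simp_all add: int_pow_def2 nat)
qed

text \<open>Here \<open>t\<close> is \<open>w\<^sup>k\<close>, and the last hypothesis is the Artin relation of length \<open>2k + 1\<close> between
  \<open>b\<close> and \<open>c\<close>.\<close>

lemma pretzel_relation_of_artin:
  assumes G: "a \<in> carrier G" "b \<in> carrier G" "c \<in> carrier G" "t \<in> carrier G"
    and ab: "a \<otimes> b \<otimes> a = b \<otimes> a \<otimes> b" and ac: "a \<otimes> c = c \<otimes> a"
    and w: "w = c \<otimes> b" and tw: "t \<otimes> w \<otimes> b = c \<otimes> (t \<otimes> w)"
  shows "t \<otimes> (a \<otimes> w \<otimes> inv a \<otimes> inv w \<otimes> inv a) = inv a \<otimes> inv w \<otimes> a \<otimes> w \<otimes> a \<otimes> inv w \<otimes> t"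
proof -
  have c1: "inv x \<otimes> (x \<otimes> y) = y" and c2: "x \<otimes> (inv x \<otimes> y) = y"
    if "x \<in> carrier G" "y \<in> carrier G" for x y
    using that by (simp_all add: m_assoc[symmetric])
  note nf = m_assoc c1 c2 G inv_mult_group
  have ac': "inv a \<otimes> inv c = inv c \<otimes> inv a"
    using arg_cong[OF ac, of "\<lambda>x. inv x"] G by (simp add: inv_mult_group)
  \<comment> \<open>Commuting \<open>a\<close> past \<open>c\<close> and braiding it with
    \<open>b\<close> reduces the word of \<open>E\<close> to c b^-1 c^-1 and that of
    \<open>F\<close> to c^-1. What remains relates only \<open>b\<close>, \<open>c\<close> and
    \<open>t\<close>.\<close>
  have "a \<otimes> w \<otimes> inv a \<otimes> inv w \<otimes> inv a = a \<otimes> c \<otimes> b \<otimes> inv a \<otimes> inv b \<otimes> (inv c \<otimes> inv a)"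
    by (simp add: w nf)
  also have "\<dots> = c \<otimes> a \<otimes> b \<otimes> inv a \<otimes> inv b \<otimes> (inv a \<otimes> inv c)"
    unfolding ac ac' ..
  also have "\<dots> = c \<otimes> (a \<otimes> b \<otimes> inv (a \<otimes> b \<otimes> a)) \<otimes> inv c" by (simp add: nf)
  also have "\<dots> = c \<otimes> inv b \<otimes> inv c" unfolding ab by (simp add: nf)
  finally have E: "a \<otimes> w \<otimes> inv a \<otimes> inv w \<otimes> inv a = c \<otimes> inv b \<otimes> inv c" .
  have "inv a \<otimes> inv w \<otimes> a \<otimes> w \<otimes> a \<otimes> inv w = inv a \<otimes> inv b \<otimes> inv c \<otimes> (a \<otimes> c) \<otimes> b \<otimes> a \<otimes> inv b \<otimes> inv c"
    by (simp add: w nf)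
  also have "\<dots> = inv a \<otimes> inv b \<otimes> (a \<otimes> b \<otimes> a) \<otimes> inv b \<otimes> inv c" unfolding ac by (simp add: nf)
  also have "\<dots> = inv c" unfolding ab by (simp add: nf)
  finally have F: "inv a \<otimes> inv w \<otimes> a \<otimes> w \<otimes> a \<otimes> inv w = inv c" .
  \<comment> \<open>After cancelling \<open>b\<close> the Artin relation reads t c b = c t c, which
    rearranges to c^-1 t = t c b^-1 c^-1.\<close>
  have "(t \<otimes> c \<otimes> b) \<otimes> b = (c \<otimes> t \<otimes> c) \<otimes> b" using tw by (simp add: w nf)
  then have "t \<otimes> c \<otimes> b = c \<otimes> t \<otimes> c" using G by (simp only: right_cancel m_closed)
  then have "inv c \<otimes> (t \<otimes> c \<otimes> b) \<otimes> inv b \<otimes> inv c = inv c \<otimes> (c \<otimes> t \<otimes> c) \<otimes> inv b \<otimes> inv c" by simp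
  then have "inv c \<otimes> t = t \<otimes> c \<otimes> inv b \<otimes> inv c" by (simp add: nf)
  then show ?thesis unfolding E F by (simp add: nf)
qed

end

subsection \<open>Matrix groups and reflections\<close>

lemma group_GL: "group (GL :: (complex ^ 'n ^ 'n) monoid)"
proof (rule groupI)
  fix x :: "complex ^ 'n ^ 'n"
  assume "x \<in> carrier GL"
  then obtain y where "x ** y = mat 1" "y ** x = mat 1" by (auto simp: GL_def invertible_def)
  then show "\<exists>y\<in>carrier GL. y \<otimes>\<^bsub>GL\<^esub> x = \<one>\<^bsub>GL\<^esub>"
    by (auto simp: GL_def invertible_def)
next
  show "\<one>\<^bsub>GL\<^esub> \<in> carrier (GL :: (complex ^ 'n ^ 'n) monoid)"
    by (simp add: GL_def invertible_def exI[of _ "mat 1"])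
qed (simp_all add: GL_def invertible_mult matrix_mul_assoc)

lemma GL_simps [simp]:
  "carrier GL = {A. invertible A}" "A \<otimes>\<^bsub>GL\<^esub> B = A ** B" "\<one>\<^bsub>GL\<^esub> = mat 1"
  by (simp_all add: GL_def)

lemma GL_int_pow_eigenvector:
  fixes A :: "complex ^ 'n ^ 'n"
  assumes A: "invertible A" and v: "A *v v = \<mu> *s v" and \<mu>: "\<mu> \<noteq> 0"
  shows "(A [^]\<^bsub>GL\<^esub> (n :: int)) *v v = \<mu> powi n *s v"
proof -
  interpret group "GL :: (complex ^ 'n ^ 'n) monoid" by (rule group_GL)
  have nat: "(A [^]\<^bsub>GL\<^esub> m) *v v = \<mu> ^ m *s v" for m :: nat
    by (induction m) (simp_all add: v vec.scale matrix_vector_mul_assoc[symmetric])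
  show ?thesis
  proof (cases "n < 0")
    case True
    let ?B = "A [^]\<^bsub>GL\<^esub> nat (- n)"
    have B: "?B \<in> carrier GL" using A by (intro nat_pow_closed) simp
    have "(inv\<^bsub>GL\<^esub> ?B) *v (\<mu> ^ nat (- n) *s v) = (inv\<^bsub>GL\<^esub> ?B \<otimes>\<^bsub>GL\<^esub> ?B) *v v"
      by (simp add: matrix_vector_mul_assoc[symmetric] nat)
    also have "\<dots> = v" using l_inv[OF B] by simp
    finally have "\<mu> ^ nat (- n) *s ((inv\<^bsub>GL\<^esub> ?B) *v v) = v" by (simp add: vec.scale)
    then have "inverse (\<mu> ^ nat (- n)) *s (\<mu> ^ nat (- n) *s ((inv\<^bsub>GL\<^esub> ?B) *v v)) =
        inverse (\<mu> ^ nat (- n)) *s v"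
      by simp
    then have "(inv\<^bsub>GL\<^esub> ?B) *v v = inverse (\<mu> ^ nat (- n)) *s v"
      using \<mu> by simp
    moreover have "A [^]\<^bsub>GL\<^esub> n = inv\<^bsub>GL\<^esub> ?B" using True by (simp only: int_pow_def2 if_True)
    ultimately show ?thesis using True by (simp add: power_int_def power_inverse)
  next
    case False
    then have "A [^]\<^bsub>GL\<^esub> n = A [^]\<^bsub>GL\<^esub> nat n" by (simp only: int_pow_def2 if_False)
    then have "(A [^]\<^bsub>GL\<^esub> n) *v v = \<mu> ^ nat n *s v" by (simp only: nat)
    then show ?thesis using False by (simp add: power_int_def)
  qed
qed

definition pairing :: "complex ^ 'n \<Rightarrow> complex ^ 'n \<Rightarrow> complex" where
  "pairing \<phi> x = (\<Sum>i\<in>UNIV. \<phi> $ i * x $ i)"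

text \<open>The map x + \<phi>(x) v: it fixes the kernel of the functional \<phi> and has eigenvalue
  1 + \<phi>(v) on the root \<open>v\<close>.\<close>

definition reflection :: "complex ^ 'n \<Rightarrow> complex ^ 'n \<Rightarrow> complex ^ 'n ^ 'n" where
  "reflection v \<phi> = mat 1 + (\<chi> i j. v $ i * \<phi> $ j)"

lemma pairing_add: "pairing \<phi> (x + y) = pairing \<phi> x + pairing \<phi> y"
  by (simp add: pairing_def algebra_simps sum.distrib)

lemma pairing_scale: "pairing \<phi> (c *s x) = c * pairing \<phi> x"
  by (simp add: pairing_def sum_distrib_left algebra_simps)

lemma pairing_diff: "pairing \<phi> (x - y) = pairing \<phi> x - pairing \<phi> y"
  by (simp add: pairing_def algebra_simps sum_subtractf)

lemma reflection_apply: "reflection v \<phi> *v x = x + pairing \<phi> x *s v"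
  unfolding reflection_def matrix_vector_mult_add_rdistrib matrix_vector_mul_lid
  by (simp add: vec_eq_iff matrix_vector_mult_def pairing_def sum_distrib_left mult_ac)

lemma invertible_reflection:
  assumes "1 + pairing \<phi> v \<noteq> 0"
  shows "invertible (reflection v \<phi>)"
proof -
  \<comment> \<open>The inverse keeps the functional and rescales the root by -1 / (1 +
    \<phi>(v)).\<close>
  let ?s = "- inverse (1 + pairing \<phi> v)"
  have "reflection v \<phi> ** reflection (?s *s v) \<phi> = mat 1 \<and> reflection (?s *s v) \<phi> ** reflection v \<phi> = mat 1"
    using assms
    by (auto simp: matrix_eq matrix_vector_mul_assoc[symmetric] reflection_apply pairing_add
        pairing_diff pairing_scale vec_eq_iff field_simps)
  then show ?thesis unfolding invertible_def by blast
qed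

lemma reflection_braid:
  assumes "pairing \<phi> v = \<mu> - 1" "pairing \<psi> u = \<mu> - 1" "pairing \<phi> u * pairing \<psi> v = - \<mu>"
  shows "reflection v \<phi> ** reflection u \<psi> ** reflection v \<phi> =
    reflection u \<psi> ** reflection v \<phi> ** reflection u \<psi>"
proof -
  \<comment> \<open>Eliminating \<mu> in favour of \<phi>(u) \<psi>(v) turns the claim into a
    polynomial identity in the pairings.\<close>
  have e: "pairing \<phi> v = - (pairing \<phi> u * pairing \<psi> v) - 1"
      "pairing \<psi> u = - (pairing \<phi> u * pairing \<psi> v) - 1"
    using assms by simp_all
  show ?thesis
    by (simp add: matrix_eq matrix_vector_mul_assoc[symmetric] reflection_apply pairing_add
        pairing_scale e vec_eq_iff algebra_simps)
qed

lemma reflection_commute: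
  assumes "pairing \<phi> u = 0" "pairing \<psi> v = 0"
  shows "reflection v \<phi> ** reflection u \<psi> = reflection u \<psi> ** reflection v \<phi>"
  using assms
  by (simp add: matrix_eq matrix_vector_mul_assoc[symmetric] reflection_apply pairing_add
      pairing_scale add_ac)

lemma reflection_eigenvector:
  "pairing \<phi> v = \<mu> - 1 \<Longrightarrow> reflection v \<phi> *v v = \<mu> *s v"
  by (simp add: reflection_apply vec_eq_iff left_diff_distrib)

subsection \<open>The three-dimensional representations\<close>

definition vec3 :: "complex \<Rightarrow> complex \<Rightarrow> complex \<Rightarrow> complex ^ 3" where
  "vec3 p q r = vector [p, q, r]"

definition diag3 :: "complex \<Rightarrow> complex \<Rightarrow> complex \<Rightarrow> complex ^ 3 ^ 3" where
  "diag3 p q r = (\<chi> i j. if i = j then vec3 p q r $ i else 0)"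

lemma vec3_nth [simp]: "vec3 p q r $ 1 = p" "vec3 p q r $ 2 = q" "vec3 p q r $ 3 = r"
  by (simp_all add: vec3_def)

lemma vec3_eq_iff: "x = y \<longleftrightarrow> x $ 1 = y $ 1 \<and> x $ 2 = y $ 2 \<and> x $ 3 = y $ 3" for x y :: "'a ^ 3"
  by (simp add: vec_eq_iff forall_3)

lemma pairing_3: "pairing \<phi> x = \<phi> $ 1 * x $ 1 + \<phi> $ 2 * x $ 2 + \<phi> $ 3 * x $ 3" for x :: "complex ^ 3"
  by (simp add: pairing_def sum_3)

lemma diag3_apply: "diag3 p q r *v x = vec3 (p * x $ 1) (q * x $ 2) (r * x $ 3)"
  by (simp add: vec3_eq_iff diag3_def matrix_vector_mult_def sum_3)

lemma diag3_mult: "diag3 p q r ** diag3 p' q' r' = diag3 (p * p') (q * q') (r * r')"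
  by (simp add: matrix_eq matrix_vector_mul_assoc[symmetric] diag3_apply mult.assoc)

lemma diag3_1: "diag3 1 1 1 = mat 1"
  by (simp add: matrix_eq diag3_apply vec3_eq_iff)

lemma invertible_diag3:
  assumes "p \<noteq> 0" "q \<noteq> 0" "r \<noteq> 0"
  shows "invertible (diag3 p q r)"
  unfolding invertible_def
  by (rule exI[of _ "diag3 (inverse p) (inverse q) (inverse r)"])
    (simp add: diag3_mult diag3_1 assms)

text \<open>Since the functional has first coordinate 1, its kernel has the basis (-q, 1, 0), (-r,
  0, 1). With \<open>v\<close> these form the columns of \<open>P\<close>, whose determinant is the
  pairing of functional and root.\<close>

lemma diagonalizable_reflection:
  assumes "pairing (vec3 1 q r) v \<noteq> 0"
  shows "diagonalizable (reflection v (vec3 1 q r))"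
proof -
  define \<phi> where "\<phi> = vec3 1 q r"
  define P :: "complex ^ 3 ^ 3" where
    "P = (\<chi> i j. if j = 1 then v $ i else if j = 2 then vec3 (- q) 1 0 $ i else vec3 (- r) 0 1 $ i)"
  have P: "P *v x = vec3 (v $ 1 * x $ 1 - q * x $ 2 - r * x $ 3) (v $ 2 * x $ 1 + x $ 2)
      (v $ 3 * x $ 1 + x $ 3)" for x
    by (simp add: vec3_eq_iff P_def matrix_vector_mult_def sum_3)
  have "det P = pairing \<phi> v"
    by (simp add: det_3 P_def pairing_3 \<phi>_def algebra_simps)
  then have inv: "invertible P" using assms by (simp add: invertible_det_nz \<phi>_def)
  define D where "D = diag3 (1 + pairing \<phi> v) 1 1"
  have "reflection v \<phi> ** P = P ** D"
    by (simp add: matrix_eq matrix_vector_mul_assoc[symmetric] reflection_apply P D_def diag3_apply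
        vec3_eq_iff pairing_3 \<phi>_def algebra_simps)
  moreover have "P ** matrix_inv P = mat 1"
    using inv unfolding invertible_def matrix_inv_def by (rule someI2_ex) blast
  ultimately have "reflection v \<phi> = P ** D ** matrix_inv P"
    by (metis matrix_mul_assoc matrix_mul_rid)
  moreover have "\<forall>i j. i \<noteq> j \<longrightarrow> D $ i $ j = 0" by (simp add: D_def diag3_def)
  ultimately show ?thesis unfolding diagonalizable_def \<phi>_def using inv by blast
qed

lemma dim_fixed_reflection:
  assumes "v \<noteq> 0"
  shows "vec.dim {x. reflection v (vec3 1 q r) *v x = x} = 2"
proof -
  let ?V = "{x. reflection v (vec3 1 q r) *v x = x}"
  let ?b = "vec3 (- q) 1 0" and ?c = "vec3 (- r) 0 1"
  have V: "?V = {x. pairing (vec3 1 q r) x = 0}"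
    using assms by (simp add: reflection_apply)
  have ne: "?b \<noteq> ?c" by (simp add: vec3_eq_iff)
  show ?thesis
  proof (rule vec.dim_unique[of "{?b, ?c}"])
    show "{?b, ?c} \<subseteq> ?V" unfolding V by (simp add: pairing_3)
    show "?V \<subseteq> vec.span {?b, ?c}"
    proof
      fix x assume "x \<in> ?V"
      then have "x $ 1 = - q * x $ 2 - r * x $ 3"
        unfolding V by (simp add: pairing_3 eq_neg_iff_add_eq_0 algebra_simps)
      then have "x = x $ 2 *s ?b + x $ 3 *s ?c"
        by (simp add: vec3_eq_iff algebra_simps)
      moreover have "x $ 2 *s ?b + x $ 3 *s ?c \<in> vec.span {?b, ?c}"
        by (intro vec.span_add vec.span_scale vec.span_base) simp_all
      ultimately show "x \<in> vec.span {?b, ?c}" by (rule ssubst)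
    qed
    show "vec.independent {?b, ?c}"
    proof (rule vec.independent_if_scalars_zero)
      fix f x assume s: "(\<Sum>x\<in>{?b, ?c}. f x *s x) = 0" and x: "x \<in> {?b, ?c}"
      have "f ?b *s ?b + f ?c *s ?c = 0" using s ne by simp
      then have "f ?b = 0 \<and> f ?c = 0" by (simp add: vec3_eq_iff)
      then show "f x = 0" using x by auto
    qed simp
  qed (simp add: ne)
qed

text \<open>The condition on the power of \<open>z\<close> encodes the Artin relation of length 2k +
  1. The values z = -1, \<mu> z = 1 and \<mu> = z are zeros of the denominators below.\<close>

locale pretzel_parameters =
  fixes k :: int and z \<mu> :: complex
  assumes z_pow: "z powi (2 * k + 1) = - 1" and z_neq: "z \<noteq> 0" "z \<noteq> - 1"
    and \<mu>_neq: "\<mu> \<noteq> 0" "\<mu> \<noteq> 1" "\<mu> * z \<noteq> 1" "\<mu> \<noteq> z"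
begin

text \<open>The basis consists of eigenvectors of \<open>w = c b\<close>, with eigenvalues \<open>1\<close>, \<open>\<mu> z\<close> and \<open>\<mu> / z\<close>. The
  reflections \<open>b\<close> and \<open>c\<close> act on the plane of the last two; \<open>v\<close> and \<open>\<phi>\<close> are determined up to scaling by
  \<open>\<phi>(y) = \<omega>(v) = 0\<close> and \<open>\<phi>(u) \<psi>(v) = - \<mu>\<close>, which make \<open>a\<close> commute with \<open>c\<close> and braid with \<open>b\<close>.\<close>

definition W :: "int \<Rightarrow> complex ^ 3 ^ 3" where
  "W n = diag3 1 ((\<mu> * z) powi n) ((\<mu> / z) powi n)"

text \<open>\<open>g\<close> and \<open>h\<close> solve g + h = \<mu> - 1, which gives
  \<open>b\<close> and \<open>c\<close> the eigenvalue \<mu>, and g - z h = z - 1, which makes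
  \<open>c ** b\<close> diagonal.\<close>

definition g where "g = (\<mu> * z - 1) / (1 + z)"
definition h where "h = (\<mu> - z) / (1 + z)"
text \<open>\<open>x1\<close> and \<open>x2\<close> solve \<psi>(v) = -\<mu> / (1 + z) and
  \<omega>(v) = 0; the first coordinate of \<open>v\<close> then makes \<phi>(v) = \<mu> -
  1.\<close>

definition x1 where "x1 = - \<mu> * z / ((\<mu> * z - 1) * (1 + z))"
definition x2 where "x2 = - \<mu> / ((\<mu> - z) * (1 + z))"
definition v where "v = vec3 (\<mu> - 1 - x1 - z * x2) x1 x2"

abbreviation "\<phi> \<equiv> vec3 1 1 z"
abbreviation "u \<equiv> vec3 0 1 1"
abbreviation "\<psi> \<equiv> vec3 0 g h"
abbreviation "y \<equiv> vec3 0 (- z) 1"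
abbreviation "\<omega> \<equiv> vec3 0 (- (g / z)) h"

abbreviation "a \<equiv> reflection v \<phi>"
abbreviation "b \<equiv> reflection u \<psi>"
abbreviation "c \<equiv> reflection y \<omega>"

lemma z1: "1 + z \<noteq> 0"
  using z_neq by (metis add.commute add_eq_0_iff)

lemma \<mu>z: "\<mu> * z - 1 \<noteq> 0" "\<mu> - z \<noteq> 0"
  using \<mu>_neq by simp_all

lemma gh: "g + h = \<mu> - 1"
proof -
  have "g + h = (\<mu> - 1) * (1 + z) / (1 + z)"
    unfolding g_def h_def add_divide_distrib[symmetric] by (simp add: algebra_simps)
  then show ?thesis using z1 by simp
qed

lemma gx: "g * x1 = - \<mu> * z / (1 + z) ^ 2" "h * x2 = - \<mu> / (1 + z) ^ 2"
  using z1 \<mu>z by (simp_all add: g_def h_def x1_def x2_def power2_eq_square)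

lemma pairings:
  "pairing \<phi> v = \<mu> - 1" "pairing \<phi> u = 1 + z" "pairing \<phi> y = 0"
  "pairing \<psi> u = \<mu> - 1" "pairing \<psi> v = - \<mu> / (1 + z)" "pairing \<omega> y = \<mu> - 1" "pairing \<omega> v = 0"
proof -
  have "pairing \<psi> v = g * x1 + h * x2" by (simp add: pairing_3 v_def)
  also have "\<dots> = - \<mu> * (1 + z) / (1 + z) ^ 2" unfolding gx add_divide_distrib[symmetric] by (simp add: algebra_simps)
  also have "\<dots> = - \<mu> / (1 + z)" using z1 by (simp add: power2_eq_square)
  finally show "pairing \<psi> v = - \<mu> / (1 + z)" .
  have "pairing \<omega> v = - (g * x1) / z + h * x2" by (simp add: pairing_3 v_def)
  also have "\<dots> = 0" unfolding gx using z_neq by simp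
  finally show "pairing \<omega> v = 0" .
qed (use gh z_neq in \<open>simp_all add: pairing_3 v_def\<close>)

lemma W_add: "W (m + n) = W m ** W n"
  using z_neq \<mu>_neq by (simp add: W_def diag3_mult power_int_add)

lemma invertibles: "invertible a" "invertible b" "invertible c" "invertible (W n)"
  using z_neq \<mu>_neq pairings by (simp_all add: W_def invertible_diag3 invertible_reflection)

lemma cb: "c ** b = W 1"
proof -
  \<comment> \<open>In terms of \<open>H\<close> and \<open>z\<close> the quantities \<mu>,
    \<open>g\<close> and \<open>h\<close> are polynomials, so \<open>z\<close> is the only
    denominator left.\<close>
  define H where "H = (1 + \<mu>) / (1 + z)"
  have H: "\<mu> = H * (1 + z) - 1" using z1 by (simp add: H_def)
  have "h * (1 + z) = \<mu> - z" "g * (1 + z) = \<mu> * z - 1"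
    using z1 by (simp_all add: g_def h_def)
  then have "h * (1 + z) = (H - 1) * (1 + z)" "g * (1 + z) = (z * H - 1) * (1 + z)"
    by (simp_all add: H algebra_simps)
  then have h: "h = H - 1" and g: "g = z * H - 1" using z1 by simp_all
  show ?thesis
    unfolding W_def g h unfolding H using z_neq(1)
    by (simp add: matrix_eq matrix_vector_mul_assoc[symmetric] reflection_apply diag3_apply
        vec3_eq_iff pairing_3 field_simps)
qed

text \<open>Write \<open>z\<^sup>-\<^sup>k = - z\<^sup>k\<^sup>+\<^sup>1\<close> to express the entries of \<open>W\<close> near \<open>k\<close> by \<open>z\<^sup>k\<close>.\<close>

lemma z_pow_k: "z powi k * z powi k * z = - 1"
proof -
  have "z powi (k + k + 1) = z powi k * z powi k * z powi 1"
    unfolding power_int_add[OF disjI1[OF z_neq(1)]] ..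
  moreover have "k + k + 1 = 2 * k + 1" by simp
  ultimately have "z powi (2 * k + 1) = z powi k * z powi k * z" by simp
  then show ?thesis using z_pow by simp
qed

lemma inverse_z_pow_k: "inverse (z powi k) = - (z powi k * z)"
  using z_pow_k by (intro inverse_unique) (simp add: algebra_simps)

text \<open>On the plane \<open>W (k + 1)\<close> has eigenvalues -z d and d. It therefore sends
  \<open>u\<close> to d y, and \<omega> composed with it is d \<psi>, so it conjugates
  \<open>b\<close> to \<open>c\<close>.\<close>

lemma W_Suc_k_b: "W (k + 1) ** b = c ** W (k + 1)"
proof -
  define d where "d = (\<mu> / z) powi (k + 1)"
  have "(\<mu> / z) powi (k + 1) = \<mu> powi (k + 1) * (inverse (z powi k) * inverse z)"
    using z_neq by (simp add: divide_inverse power_int_mult_distrib power_int_inverse power_int_add)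
  then have d: "d = - (\<mu> powi (k + 1) * z powi k)"
    using z_neq by (simp add: d_def inverse_z_pow_k)
  have "(\<mu> * z) powi (k + 1) = - z * d"
    using z_neq by (simp add: d power_int_mult_distrib power_int_add)
  then have W: "W (k + 1) = diag3 1 (- z * d) d" by (simp add: W_def d_def)
  show ?thesis
    unfolding W using z_neq
    by (simp add: matrix_eq matrix_vector_mul_assoc[symmetric] reflection_apply diag3_apply
        vec3_eq_iff pairing_3 field_simps)
qed

section \<open>The representation of the knot group and its longitude\<close>

interpretation GL: group "GL :: (complex ^ 3 ^ 3) monoid" by (rule group_GL)

lemma W_pow: "W 1 [^]\<^bsub>GL\<^esub> n = W n" for n :: int
  by (rule GL.int_pow_eq_additive) (simp_all add: invertibles W_add)

definition gens :: "gen \<Rightarrow> complex ^ 3 ^ 3" where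
  "gens x = (case x of Gen_m \<Rightarrow> a | Gen_w \<Rightarrow> W 1)"

lemma gens_closed: "gens x \<in> carrier GL"
  by (cases x) (simp_all add: gens_def invertibles)

lemmas word_eval_gens =
  GL.word_eval_append[of gens, OF gens_closed] GL.word_eval_letter[of gens, OF gens_closed]
  GL.word_eval_word_inv[of gens, OF gens_closed] GL.word_eval_word_pow[of gens, OF gens_closed]

lemma pretzel_relation:
  "word_eval GL gens (word_pow w_word k @ E_word) = word_eval GL gens (F_word @ word_pow w_word k)"
proof -
  have "W k \<otimes>\<^bsub>GL\<^esub> (a \<otimes>\<^bsub>GL\<^esub> W 1 \<otimes>\<^bsub>GL\<^esub> inv\<^bsub>GL\<^esub> a \<otimes>\<^bsub>GL\<^esub> inv\<^bsub>GL\<^esub> W 1 \<otimes>\<^bsub>GL\<^esub> inv\<^bsub>GL\<^esub> a) =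
      inv\<^bsub>GL\<^esub> a \<otimes>\<^bsub>GL\<^esub> inv\<^bsub>GL\<^esub> W 1 \<otimes>\<^bsub>GL\<^esub> a \<otimes>\<^bsub>GL\<^esub> W 1 \<otimes>\<^bsub>GL\<^esub> a \<otimes>\<^bsub>GL\<^esub> inv\<^bsub>GL\<^esub> W 1 \<otimes>\<^bsub>GL\<^esub> W k"
  proof (rule GL.pretzel_relation_of_artin[of a b c])
    show "a \<otimes>\<^bsub>GL\<^esub> b \<otimes>\<^bsub>GL\<^esub> a = b \<otimes>\<^bsub>GL\<^esub> a \<otimes>\<^bsub>GL\<^esub> b"
      using reflection_braid[of \<phi> v \<mu> \<psi> u] pairings z1 by simp
    show "a \<otimes>\<^bsub>GL\<^esub> c = c \<otimes>\<^bsub>GL\<^esub> a"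
      using reflection_commute[of \<phi> y \<omega> v] pairings by simp
    show "W 1 = c \<otimes>\<^bsub>GL\<^esub> b" by (simp add: cb)
    show "W k \<otimes>\<^bsub>GL\<^esub> W 1 \<otimes>\<^bsub>GL\<^esub> b = c \<otimes>\<^bsub>GL\<^esub> (W k \<otimes>\<^bsub>GL\<^esub> W 1)"
      using W_Suc_k_b by (simp add: W_add)
  qed (simp_all add: invertibles)
  then show ?thesis
    unfolding E_word_def F_word_def word_eval_gens
    by (simp only: gens_def gen.case W_pow) (simp add: matrix_mul_assoc)
qed

text \<open>The word applied to \<open>v\<close> is the longitude without its final power of \<open>m\<close>.\<close>

lemma longitude_eigenvector:
  "W 1 *v (a *v (W (k - 1) *v (a *v (W 1 *v (a *v (W (k - 1) *v (a *v (W 1 *v v)))))))) =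
    \<mu> powi (2 * k) *s v"
proof -
  \<comment> \<open>Here \<open>t\<close> is \<psi>(v). Read from the right, the word carries
    \<open>v\<close> through multiples of (0, z, 1/z), (0, 1, -z), (0, -z^2, 1/z) and
    \<open>u\<close> back to a multiple of \<open>v\<close>.\<close>
  define t where "t = - \<mu> / (1 + z)"
  define m where "m = \<mu> powi k"
  define p where "p = z powi k"
  have scale: "A *v (q *s x) = q *s (A *v x)" for A :: "complex ^ 3 ^ 3" and q x
    by (rule vec.scale)
  have t: "t * (1 + z) = - \<mu>" using z1 by (simp add: t_def)
  have pz: "p * p * z = - 1" using z_pow_k by (simp add: p_def)
  have ip: "inverse p = - (p * z)" using inverse_z_pow_k by (simp add: p_def)
  have W1: "W 1 *v x = vec3 (x $ 1) (\<mu> * z * x $ 2) (\<mu> / z * x $ 3)" for x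
    by (simp add: W_def diag3_apply)
  have "(\<mu> / z) powi (k - 1) = m * inverse p * (z / \<mu>)"
    using z_neq \<mu>_neq by (simp add: m_def p_def power_int_diff power_int_divide_distrib field_simps)
  then have "(\<mu> / z) powi (k - 1) = - (m * p * z ^ 2 / \<mu>)"
    by (simp add: ip power2_eq_square)
  moreover have "(\<mu> * z) powi (k - 1) = m * p / (\<mu> * z)"
    using z_neq \<mu>_neq by (simp add: m_def p_def power_int_diff power_int_mult_distrib)
  ultimately have Wk: "W (k - 1) *v x =
      vec3 (x $ 1) (m * p / (\<mu> * z) * x $ 2) (- (m * p * z ^ 2 / \<mu>) * x $ 3)" for x
    by (simp add: W_def diag3_apply)
  have "(\<mu> * z - 1) * x1 = t * z" "(\<mu> - z) * x2 = t"
    using \<mu>z z1 by (simp_all add: x1_def x2_def t_def)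
  then have "(\<mu> * z - 1) * x1 = t * z" "(\<mu> / z - 1) * x2 = t / z"
    using z_neq by (simp_all add: field_simps)
  then have "W 1 *v v = v + t *s vec3 0 z (1 / z)"
    by (simp add: W1 v_def vec3_eq_iff algebra_simps)
  moreover have "a *v (t *s vec3 0 z (1 / z)) = t *s vec3 0 z (1 / z) - \<mu> *s v"
  proof -
    have e: "t * q + t * (z * q) = - (\<mu> * q)" for q
      using arg_cong[OF t, of "\<lambda>x. x * q"] by (simp add: algebra_simps)
    show ?thesis
      using z_neq by (simp add: vec.scale reflection_apply pairing_3 vec3_eq_iff e algebra_simps)
  qed
  moreover have "a *v v = \<mu> *s v" using reflection_eigenvector pairings by blast
  \<comment> \<open>The multiples of \<open>v\<close> cancel because \<phi>(0, z, 1/z) = 1 + z and t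
    (1 + z) = -\<mu>.\<close>
  ultimately have aWv: "a *v (W 1 *v v) = t *s vec3 0 z (1 / z)" and Wv: "W 1 *v v = v + t *s vec3 0 z (1 / z)"
    by (simp_all add: vec.add)
  have s1: "W (k - 1) *v (t *s vec3 0 z (1 / z)) = (t * m * p / \<mu>) *s vec3 0 1 (- z)"
    using z_neq by (simp add: Wk vec3_eq_iff power2_eq_square)
  have W1q: "W 1 *v vec3 0 1 (- z) = (- \<mu>) *s y"
    using z_neq by (simp add: W1 vec3_eq_iff)
  have "a *v vec3 0 1 (- z) = vec3 0 1 (- z) + (1 - z ^ 2) *s v"
    by (simp add: reflection_apply pairing_3 power2_eq_square)
  then have "W 1 *v (a *v vec3 0 1 (- z)) = (- \<mu>) *s y + (1 - z ^ 2) *s (W 1 *v v)"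
    by (simp only: vec.add vec.scale W1q)
  moreover have "a *v y = y" using pairings by (simp add: reflection_apply)
  ultimately have "a *v (W 1 *v (a *v vec3 0 1 (- z))) = (- \<mu>) *s y + ((1 - z ^ 2) * t) *s vec3 0 z (1 / z)"
    by (simp only: vec.add vec.scale aWv vector_smult_assoc)
  also have "(1 - z ^ 2) * t = - \<mu> * (1 - z)"
    using arg_cong[OF t, of "\<lambda>x. x * (1 - z)"] by (simp add: algebra_simps power2_eq_square)
  also have "(- \<mu>) *s y + (- \<mu> * (1 - z)) *s vec3 0 z (1 / z) = (- \<mu>) *s vec3 0 (- (z ^ 2)) (1 / z)"
    using z_neq by (simp add: vec3_eq_iff field_simps power2_eq_square)
  finally have s2: "a *v (W 1 *v (a *v vec3 0 1 (- z))) = (- \<mu>) *s vec3 0 (- (z ^ 2)) (1 / z)" .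
  have s3: "W (k - 1) *v ((- \<mu>) *s vec3 0 (- (z ^ 2)) (1 / z)) = (m * p * z) *s u"
    using z_neq \<mu>_neq by (simp add: Wk vec3_eq_iff power2_eq_square)
  have "a *v u = u + (1 + z) *s v" by (simp add: reflection_apply pairings)
  then have "W 1 *v (a *v u) = W 1 *v u + (1 + z) *s (v + t *s vec3 0 z (1 / z))"
    by (simp only: vec.add vec.scale Wv)
  also have "\<dots> = (1 + z) *s v + (W 1 *v u + (t * (1 + z)) *s vec3 0 z (1 / z))"
    by (simp add: vector_add_ldistrib vector_smult_assoc mult.commute add.left_commute)
  \<comment> \<open>\<open>W 1\<close> maps \<open>u\<close> to \<mu> (0, z, 1/z), which t (1 + z) =
    -\<mu> cancels.\<close>
  also have "W 1 *v u + (t * (1 + z)) *s vec3 0 z (1 / z) = 0"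
    unfolding t by (simp add: W1 vec3_eq_iff)
  finally have s4: "W 1 *v (a *v u) = (1 + z) *s v" by simp
  \<comment> \<open>The product of the scalars picked up on the way is (-\<mu>) m^2 (-1) / \<mu> =
    m^2.\<close>
  have "(t * m * p / \<mu>) * (m * p * z) * (1 + z) = (t * (1 + z)) * m * m * (p * p * z) / \<mu>"
    by (simp add: algebra_simps)
  also have "\<dots> = \<mu> powi (2 * k)"
    unfolding t pz mult_2[of k] power_int_add[OF disjI1[OF \<mu>_neq(1)]] m_def[symmetric]
    using \<mu>_neq by simp
  finally have "(t * m * p / \<mu>) *s ((m * p * z) *s ((1 + z) *s v)) = \<mu> powi (2 * k) *s v"
    by (simp only: vector_smult_assoc mult.assoc)
  then show ?thesis
    by (simp only: aWv s1 s2 s3 s4 scale[of _ "t * m * p / \<mu>"] scale[of _ "m * p * z"])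
qed

lemma ex_representation:
  obtains \<rho> where "KCH_rep k \<rho>" "\<rho> (meridian k) = a"
    "\<rho> (pres_class (pretzel_rel k) w_word) = W 1"
    "\<rho> (longitude k) *v v = \<mu> powi (- (2 * k + 6)) *s v"
proof -
  obtain \<rho> where \<rho>: "\<rho> \<in> hom (presented_group (pretzel_rel k)) GL"
      "\<And>w. \<rho> (pres_class (pretzel_rel k) w) = word_eval GL gens w"
  proof (rule GL.presented_group_hom[of gens "pretzel_rel k"])
    show "gens x \<in> carrier GL" for x by (rule gens_closed)
    show "word_eval GL gens w = word_eval GL gens w'" if "(w, w') \<in> pretzel_rel k" for w w'
      using that pretzel_relation by (auto simp: pretzel_rel_def)
  qed blast
  have m: "\<rho> (meridian k) = a"
    unfolding meridian_def \<rho>(2) word_eval_gens by (simp add: gens_def)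
  have w: "\<rho> (pres_class (pretzel_rel k) w_word) = W 1"
    unfolding \<rho>(2) word_eval_gens by (simp add: gens_def)
  have v0: "v \<noteq> 0" using pairings(1) \<mu>_neq by (auto simp: pairing_def)
  have "KCH_rep k \<rho>"
    unfolding KCH_rep_def pretzel_group_def m
    using \<rho>(1) pairings(1) \<mu>_neq v0
    by (simp add: dim_fixed_reflection diagonalizable_reflection)
  moreover have "\<rho> (longitude k) *v v = \<mu> powi (- (2 * k + 6)) *s v"
  proof -
    have av: "a *v v = \<mu> *s v" using reflection_eigenvector pairings by blast
    \<comment> \<open>The framing correction of the longitude, a power of the meridian, contributes
      the first factor.\<close>
    have "\<mu> powi (- (4 * k + 6)) * \<mu> powi (2 * k) = \<mu> powi (- (2 * k + 6))"
      using \<mu>_neq by (simp add: power_int_add[symmetric])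
    then show ?thesis
      unfolding longitude_def \<rho>(2) longitude_word_def word_eval_gens
      using GL_int_pow_eigenvector[OF invertibles(1) av \<mu>_neq(1), of "- (4 * k + 6)"]
      by (simp only: gens_def gen.case W_pow GL_simps matrix_vector_mul_assoc[symmetric] vec.scale
          longitude_eigenvector vector_smult_assoc)
  qed
  ultimately show thesis using m w by (intro that)
qed

section \<open>Irreducibility\<close>

lemma v_nonzero:
  assumes "\<mu> ^ 2 * z + z - \<mu> * (z ^ 2 - z + 1) \<noteq> 0"
  shows "v $ 1 \<noteq> 0" "v $ 2 \<noteq> 0" "v $ 3 \<noteq> 0"
proof -
  have X: "x1 * ((\<mu> * z - 1) * (1 + z)) = - \<mu> * z" "x2 * ((\<mu> - z) * (1 + z)) = - \<mu>"
    using z1 \<mu>z by (simp_all add: x1_def x2_def)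
  \<comment> \<open>Clearing denominators shows that the quadratic in the hypothesis is the
    numerator of \<open>v $ 1\<close>, up to the nonzero factors \<mu> - 1 and 1 + z.\<close>
  have "v $ 1 * ((\<mu> * z - 1) * (\<mu> - z) * (1 + z)) =
      (\<mu> - 1) * ((\<mu> * z - 1) * (\<mu> - z) * (1 + z))
      - (x1 * ((\<mu> * z - 1) * (1 + z))) * (\<mu> - z) - z * (x2 * ((\<mu> - z) * (1 + z))) * (\<mu> * z - 1)"
    by (simp add: v_def algebra_simps)
  also have "\<dots> = (\<mu> - 1) * (1 + z) * (\<mu> ^ 2 * z + z - \<mu> * (z ^ 2 - z + 1))"
    unfolding X by (simp add: algebra_simps power2_eq_square)
  finally show "v $ 1 \<noteq> 0" using assms z1 \<mu>_neq by auto
  show "v $ 2 \<noteq> 0" "v $ 3 \<noteq> 0"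
    using z_neq \<mu>_neq z1 \<mu>z by (simp_all add: v_def x1_def x2_def)
qed

text \<open>\<open>W 1\<close> has three distinct eigenvalues, so an invariant subspace contains a
  basis vector for each nonzero coordinate of its elements. All coordinates of \<phi> are nonzero,
  so \<open>a\<close> moves one of these vectors by a nonzero multiple of \<open>v\<close>; as all
  coordinates of \<open>v\<close> are nonzero, the subspace is everything.\<close>

lemma irreducible_representation:
  assumes W_neq: "\<mu> * z \<noteq> \<mu> / z" "\<mu> / z \<noteq> 1"
    and v_neq: "\<mu> ^ 2 * z + z - \<mu> * (z ^ 2 - z + 1) \<noteq> 0"
    and m: "\<rho> (meridian k) = a" and w: "\<rho> (pres_class (pretzel_rel k) w_word) = W 1"
  shows "irreducible_rep k \<rho>"
  unfolding irreducible_rep_def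
proof (intro allI impI)
  fix S assume "vec.subspace S \<and> (\<forall>g\<in>carrier (pretzel_group k). \<forall>x\<in>S. \<rho> g *v x \<in> S)"
  then have sub: "vec.subspace S" and inv: "\<And>g x. g \<in> carrier (pretzel_group k) \<Longrightarrow> x \<in> S \<Longrightarrow> \<rho> g *v x \<in> S"
    by blast+
  have gens: "meridian k \<in> carrier (pretzel_group k)"
      "pres_class (pretzel_rel k) w_word \<in> carrier (pretzel_group k)"
    by (simp_all add: meridian_def pretzel_group_def pres_class_carrier)
  have aS: "a *v x \<in> S" and WS: "W 1 *v x \<in> S" if "x \<in> S" for x
    using inv[OF gens(1) that] inv[OF gens(2) that] by (simp_all add: m w)
  have scale: "x \<in> S" if "r *s x \<in> S" "r \<noteq> 0" for r x
    using vec.subspace_scale[OF sub that(1), of "inverse r"] that(2) by (simp add: vector_smult_assoc)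
  define \<alpha> where "\<alpha> = \<mu> * z"
  define \<beta> where "\<beta> = \<mu> / z"
  have \<alpha>\<beta>: "\<alpha> \<noteq> 1" "\<beta> \<noteq> 1" "\<alpha> \<noteq> \<beta>" using W_neq \<mu>_neq by (simp_all add: \<alpha>_def \<beta>_def)
  have W1: "W 1 *v x = vec3 (x $ 1) (\<alpha> * x $ 2) (\<beta> * x $ 3)" for x
    by (simp add: W_def diag3_apply \<alpha>_def \<beta>_def)
  \<comment> \<open>With two eigenvalues of \<open>W 1\<close> as the roots of the quadratic, this
    expression is a multiple of the projection to the third eigenline.\<close>
  have quad: "W 1 *v (W 1 *v x) - q *s (W 1 *v x) + r *s x \<in> S" if "x \<in> S" for x q r
    by (intro vec.subspace_add[OF sub] vec.subspace_diff[OF sub] vec.subspace_scale[OF sub] WS that)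
  have e1: "vec3 1 0 0 \<in> S" if x: "x \<in> S" "x $ 1 \<noteq> 0" for x
  proof -
    have "W 1 *v (W 1 *v x) - (\<alpha> + \<beta>) *s (W 1 *v x) + (\<alpha> * \<beta>) *s x =
        ((1 - \<alpha>) * (1 - \<beta>) * x $ 1) *s vec3 1 0 0"
      by (simp add: W1 vec3_eq_iff algebra_simps)
    then show ?thesis using quad[OF x(1), of "\<alpha> + \<beta>" "\<alpha> * \<beta>"] scale x(2) \<alpha>\<beta> by auto
  qed
  have e2: "vec3 0 1 0 \<in> S" if x: "x \<in> S" "x $ 2 \<noteq> 0" for x
  proof -
    have "W 1 *v (W 1 *v x) - (1 + \<beta>) *s (W 1 *v x) + \<beta> *s x =
        ((\<alpha> - 1) * (\<alpha> - \<beta>) * x $ 2) *s vec3 0 1 0"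
      by (simp add: W1 vec3_eq_iff algebra_simps)
    then show ?thesis using quad[OF x(1), of "1 + \<beta>" "\<beta>"] scale x(2) \<alpha>\<beta> by auto
  qed
  have e3: "vec3 0 0 1 \<in> S" if x: "x \<in> S" "x $ 3 \<noteq> 0" for x
  proof -
    have "W 1 *v (W 1 *v x) - (1 + \<alpha>) *s (W 1 *v x) + \<alpha> *s x =
        ((\<beta> - 1) * (\<beta> - \<alpha>) * x $ 3) *s vec3 0 0 1"
      by (simp add: W1 vec3_eq_iff algebra_simps)
    then show ?thesis using quad[OF x(1), of "1 + \<alpha>" "\<alpha>"] scale x(2) \<alpha>\<beta> by auto
  qed
  show "S = {0} \<or> S = UNIV"
  proof (cases "S = {0}")
    case False
    then obtain x where x: "x \<in> S" "x \<noteq> 0" using vec.subspace_0[OF sub] by blast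
    have "\<exists>e\<in>S. pairing \<phi> e \<noteq> 0"
    proof -
      consider "x $ 1 \<noteq> 0" | "x $ 2 \<noteq> 0" | "x $ 3 \<noteq> 0" using x(2) by (auto simp: vec3_eq_iff)
      then show ?thesis
      proof cases
        case 1
        then show ?thesis using e1[OF x(1)] by (intro bexI[of _ "vec3 1 0 0"]) (simp_all add: pairing_3)
      next
        case 2
        then show ?thesis using e2[OF x(1)] by (intro bexI[of _ "vec3 0 1 0"]) (simp_all add: pairing_3)
      next
        case 3
        then show ?thesis
          using e3[OF x(1)] z_neq by (intro bexI[of _ "vec3 0 0 1"]) (simp_all add: pairing_3)
      qed
    qed
    then obtain e where e: "e \<in> S" "pairing \<phi> e \<noteq> 0" by blast
    have "a *v e - e \<in> S" by (intro vec.subspace_diff[OF sub] aS e(1))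
    then have "pairing \<phi> e *s v \<in> S" by (simp add: reflection_apply)
    then have v: "v \<in> S" using scale e(2) by blast
    note e123 = e1[OF v v_nonzero(1)[OF v_neq]] e2[OF v v_nonzero(2)[OF v_neq]]
      e3[OF v v_nonzero(3)[OF v_neq]]
    have "y \<in> S" for y
    proof -
      have "y = y $ 1 *s vec3 1 0 0 + y $ 2 *s vec3 0 1 0 + y $ 3 *s vec3 0 0 1"
        by (simp add: vec3_eq_iff)
      moreover have "y $ 1 *s vec3 1 0 0 + y $ 2 *s vec3 0 1 0 + y $ 3 *s vec3 0 0 1 \<in> S"
        by (intro vec.subspace_add[OF sub] vec.subspace_scale[OF sub] e123)
      ultimately show ?thesis by (rule ssubst)
    qed
    then show ?thesis by blast
  qed simp
qed

end

section \<open>Choice of the parameters and conclusion\<close>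

lemma ex_odd_root_minus_one:
  assumes "k \<noteq> - 1" "k \<noteq> (0 :: int)"
  obtains z :: complex where "z powi (2 * k + 1) = - 1" "norm z = 1" "z ^ 2 \<noteq> 1"
proof -
  define x where "x = pi / of_int (2 * k + 1)"
  have n: "(of_int (2 * k + 1) :: real) \<noteq> 0"
    unfolding of_int_eq_0_iff by presburger
  have "cis x powi (2 * k + 1) = cis (of_int (2 * k + 1) * x)" by (rule cis_power_int)
  also have "of_int (2 * k + 1) * x = pi" using n by (simp add: x_def)
  finally have "cis x powi (2 * k + 1) = - 1" by simp
  \<comment> \<open>A square equal to 1 would make 1 / (2k + 1) an integer, which happens only for
    the two excluded values of \<open>k\<close>.\<close>
  moreover have "cis x ^ 2 \<noteq> 1"
  proof
    assume "cis x ^ 2 = 1"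
    then have "cis x = 1 \<or> cis x = - 1" by (simp add: power2_eq_1_iff)
    then have "sin x = 0" by (auto simp: complex_eq_iff)
    then obtain i :: int where "x = of_int i * pi" by (auto simp: sin_zero_iff_int2)
    then have "pi * of_int (i * (2 * k + 1)) = pi * 1" using n by (simp add: x_def field_simps)
    then have "of_int (i * (2 * k + 1)) = (1 :: real)" by (simp only: mult_cancel_left pi_neq_zero) simp
    then have "i * (2 * k + 1) = 1" by linarith
    then have "2 * k + 1 = 1 \<or> 2 * k + 1 = - 1" by (auto simp: zmult_eq_1_iff)
    then show False using assms by auto
  qed
  ultimately show thesis by (intro that[of "cis x"]) simp_all
qed

theorem theorem1p4:
  fixes k :: int
  assumes "k \<noteq> -1" and "k \<noteq> 0"
  shows "(\<exists>\<rho> :: gen word set \<Rightarrow> complex ^ 3 ^ 3. KCH_rep k \<rho> \<and> irreducible_rep k \<rho>) \<and>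
    (\<forall>A. is_A_polynomial k TYPE(3) A \<longrightarrow>
       1 - Poly_Mapping.single (1, 2 * k + 6) 1 dvd A)"
proof (intro conjI allI impI)
  obtain z :: complex where z: "z powi (2 * k + 1) = - 1" "norm z = 1" "z ^ 2 \<noteq> 1"
    using ex_odd_root_minus_one[OF assms] .
  have z0: "z \<noteq> 0" "z \<noteq> - 1" using z(2,3) by auto
  have params: "pretzel_parameters k z \<mu>" if "\<mu> \<noteq> 0" "\<mu> \<noteq> 1" "\<mu> * z \<noteq> 1" "\<mu> \<noteq> z" for \<mu>
    using z(1) z0 that by unfold_locales
  \<comment> \<open>The irreducible representation is taken at \<mu> = 2; since \<open>z\<close> has
    norm 1, comparing norms rules out these coincidences.\<close>
  have two: "2 * z \<noteq> 1" "2 \<noteq> z" "2 / z \<noteq> 1"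
    using z(2) z0 by (auto simp: norm_mult dest: arg_cong[of _ _ norm])
  \<comment> \<open>At \<mu> = 2 the quadratic of \<open>v_nonzero\<close> is 7 z - (2 z^2 + 2), a
    difference of terms of norm 7 and at most 4.\<close>
  have "norm (2 * z ^ 2 + 2) \<le> 4"
    using norm_triangle_ineq[of "2 * z ^ 2" 2] z(2) by (simp add: norm_mult norm_power)
  moreover have "norm (7 * z) = 7" using z(2) by (simp add: norm_mult)
  ultimately have "norm (7 * z) \<noteq> norm (2 * z ^ 2 + 2)" by linarith
  then have "7 * z \<noteq> 2 * z ^ 2 + 2" by metis
  then have irr: "2 ^ 2 * z + z - 2 * (z ^ 2 - z + 1) \<noteq> 0" by (simp add: algebra_simps)
  have "2 * z \<noteq> 2 / z" using z(3) z0 by (simp add: field_simps power2_eq_square)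
  note irr = two(3) this irr
  show "\<exists>\<rho> :: gen word set \<Rightarrow> complex ^ 3 ^ 3. KCH_rep k \<rho> \<and> irreducible_rep k \<rho>"
  proof -
    interpret pretzel_parameters k z 2
      by (rule params) (use two in simp_all)
    obtain \<rho> where "KCH_rep k \<rho>" "\<rho> (meridian k) = a"
        "\<rho> (pres_class (pretzel_rel k) w_word) = W 1"
      using ex_representation by blast
    then show ?thesis using irreducible_representation irr by blast
  qed
  fix A assume A: "is_A_polynomial k TYPE(3) A"
  \<comment> \<open>Only the finitely many values of \<mu> that violate the parameter conditions are
    removed; the second coordinate keeps the resulting points distinct.\<close>
  define M where "M = UNIV - {0, 1, inverse z, z}"
  have "(\<lambda>\<mu>. (\<mu> powi (- (2 * k + 6)), \<mu>)) ` M \<subseteq> KCH_eigenvalues k TYPE(3) \<inter> slope_curve (2 * k + 6)"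
  proof
    fix p assume "p \<in> (\<lambda>\<mu>. (\<mu> powi (- (2 * k + 6)), \<mu>)) ` M"
    then obtain \<mu> where p: "p = (\<mu> powi (- (2 * k + 6)), \<mu>)" and \<mu>: "\<mu> \<in> M" by blast
    interpret pretzel_parameters k z \<mu>
      by (rule params) (use \<mu> z0 in \<open>auto simp: M_def dest: inverse_unique\<close>)
    obtain \<rho> where \<rho>: "KCH_rep k \<rho>" "\<rho> (meridian k) = a"
        "\<rho> (longitude k) *v v = \<mu> powi (- (2 * k + 6)) *s v"
      using ex_representation by blast
    have "v \<noteq> 0" using pairings(1) \<mu>_neq by (auto simp: pairing_def)
    moreover have "\<rho> (meridian k) *v v = \<mu> *s v"
      unfolding \<rho>(2) using reflection_eigenvector pairings by blast
    ultimately have "p \<in> KCH_eigenvalues k TYPE(3)"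
      unfolding p KCH_eigenvalues_def mem_Collect_eq prod.case using \<rho>(1,3) \<mu>_neq by blast
    moreover have "p \<in> slope_curve (2 * k + 6)"
      unfolding p slope_curve_altdef using \<mu>_neq by blast
    ultimately show "p \<in> KCH_eigenvalues k TYPE(3) \<inter> slope_curve (2 * k + 6)" ..
  qed
  moreover have "infinite M"
    unfolding M_def by (rule Diff_infinite_finite) (simp_all add: infinite_UNIV_char_0)
  then have "infinite ((\<lambda>\<mu>. (\<mu> powi (- (2 * k + 6)), \<mu>)) ` M)"
    by (subst finite_image_iff) (auto intro: inj_onI)
  ultimately have "infinite (KCH_eigenvalues k TYPE(3) \<inter> slope_curve (2 * k + 6))"
    using finite_subset by blast
  then show "1 - Poly_Mapping.single (1, 2 * k + 6) 1 dvd A"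
    using slope_polynomial_dvd_A_polynomial A by blast
qed

end
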